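(* Let $(\boldsymbol{u}_h,p_h)\in X_h\times M_h$ be the solution of the discrete Darcy--Forchheimer problem: for all $\boldsymbol{v}\in X_h$ and $q\in M_h$, $$\frac{\mu}{\rho}\int_\Omega \boldsymbol{K}^{-1}\boldsymbol{u}_h\cdot\boldsymbol{v}\,dx+\frac{\beta}{\rho}\int_\Omega|\boldsymbol{u}_h|\boldsymbol{u}_h\cdot\boldsymbol{v}\,dx-\int_\Omega p_h\operatorname{div}\boldsymbol{v}\,dx=\int_\Omega\boldsymbol{f}\cdot\boldsymbol{v}\,dx,\qquad \int_\Omega q\operatorname{div}\boldsymbol{u}_h\,dx=\int_\Omega gq\,dx .$$ Given $\epsilon>0$ and $p_h^{(0)}\in M_h$, let $\{(\boldsymbol{u}_h^{(n)},p_h^{(n)})\}$ be the sequence generated by the augmented Lagrangian method: for $n=0,1,2,\dots$, $$\boldsymbol{u}_h^{(n+1)}=\operatorname*{arg\,min}_{\boldsymbol{v}\in X_h}\Big\{F(\boldsymbol{v})-\int_\Omega p_h^{(n)}\operatorname{div}\boldsymbol{v}\,dx+\frac1{2\epsilon}\int_\Omega(\operatorname{div}\boldsymbol{v}-g_h)^2\,dx\Big\},\qquad p_h^{(n+1)}=p_h^{(n)}-\epsilon^{-1}(\operatorname{div}\boldsymbol{u}_h^{(n+1)}-g_h).$$ Then there exists a constant $\mu_*>0$, independent of $\epsilon$, such that for all $n\ge 0$, $$D_F^{\mathrm{sym}}(\boldsymbol{u}_h^{(n+1)},\boldsymbol{u}_h)\le\frac{\epsilon}{4}\|p_h^{(n)}-p_h\|_{L^2(\Omega)}^2\le\frac{\epsilon}{4}\Big(\frac{\epsilon}{\mu_*+\epsilon}\Big)^{2n}\|p_h^{(0)}-p_h\|_{L^2(\Omega)}^2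 .$$
   Context: $\Omega\subset\mathbb{R}^d$, $d\in\{2,3\}$, is a bounded polyhedral domain. The data are: the viscosity $\mu>0$, the density $\rho>0$, the Forchheimer coefficient $\beta\ge 0$, the permeability tensor $\boldsymbol{K}$ (symmetric, with $\boldsymbol{K}$ and $\boldsymbol{K}^{-1}$ bounded and uniformly positive definite on $\Omega$), a body force $\boldsymbol{f}$ (such that $\boldsymbol{v}\mapsto\int_\Omega\boldsymbol{f}\cdot\boldsymbol{v}\,dx$ is a bounded linear functional on $X$), and a source $g\in L^2(\Omega)$. Spaces: $X=\{\boldsymbol{v}\in L^3(\Omega)^d:\operatorname{div}\boldsymbol{v}\in L^2(\Omega)\}$ and $M=L^2(\Omega)$. $X_h\times M_h\subset X\times M$ is a (finite-dimensional) Raviart--Thomas-type conforming mixed finite element space on a quasi-uniform partition $\mathcal{T}_h$ of $\Omega$; e.g. for $d=2$ and rectangular elements $T$, the local spaces are $X_h(T)=Q_{k+1,k}(T)\oplus Q_{k,k+1}(T)$, $M_h(T)=Q_{k,k}(T)$ with $k\ge0$, where $Q_{k,\ell}(T)$ is the space of polynomials of degree at most $k$ in the first and at most $\ell$ in the second variable. As is standard for such pairs, $\operatorname{div}X_h=M_h$, and the discrete problem has a unique solution. No boundary condition is imposed on the velocity space (the boundary condition is $p=0$ on $\partial\Omega$, imposed naturally). $g_h$ is the $L^2(\Omega)$-orthogonal projection of $g$ onto $M_h$, and $$F(\boldsymbol{v})=\frac{\mu}{2\rho}\int_\Omega\boldsymbol{K}^{-1}\boldsymbol{v}\cdot\boldsymbol{v}\,dx+\frac{\beta}{3\rho}\int_\Omega|\boldsymbol{v}|^3\,dx-\int_\Omega\boldsymbol{f}\cdot\boldsymbol{v}\,dx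 .$$ Symmetrized Bregman divergence on $X_h$: $D_F^{\mathrm{sym}}(\boldsymbol{v},\boldsymbol{w})=\langle F'(\boldsymbol{v})-F'(\boldsymbol{w}),\boldsymbol{v}-\boldsymbol{w}\rangle$, where $F'$ is the Gâteaux derivative of $F$ on $X_h$ and $\langle\cdot,\cdot\rangle$ the duality pairing. "Independent of $\epsilon$" means that, with all other data (including $p_h^{(0)}$) fixed, the same $\mu_*$ works for every $\epsilon>0$. *)

theory Defs
  imports "HOL-Analysis.Analysis"
begin

section \<open>Domain and partition\<close>

definition polyhedral_domain :: "(real ^ 'd) set \<Rightarrow> bool" where
  "polyhedral_domain \<Omega> \<longleftrightarrow>
     open \<Omega> \<and> connected \<Omega> \<and> \<Omega> \<noteq> {} \<and>
     (\<exists>\<P>. finite \<P> \<and> (\<forall>P\<in>\<P>. polytope P) \<and> frontier \<Omega> = \<Union>\<P>)"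

definition partition_of_domain :: "(real ^ 'd) set \<Rightarrow> (real ^ 'd) set set \<Rightarrow> bool" where
  "partition_of_domain \<Omega> \<T> \<longleftrightarrow>
     finite \<T> \<and> \<Union>\<T> = closure \<Omega> \<and>
     (\<forall>T\<in>\<T>. polytope T \<and> interior T \<noteq> {} \<and> interior T \<subseteq> \<Omega>) \<and>
     (\<forall>S\<in>\<T>. \<forall>T\<in>\<T>. S \<noteq> T \<longrightarrow> interior S \<inter> interior T = {})"

text \<open>Every element contains a ball whose radius is comparable, with constant \<open>\<sigma>\<close>, to the
  global mesh size; this expresses shape regularity together with comparability of all
  element diameters.\<close>

definition quasi_uniform :: "real \<Rightarrow> (real ^ 'd) set set \<Rightarrow> bool" where
  "quasi_uniform \<sigma> \<T> \<longleftrightarrow>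
     \<sigma> > 0 \<and> (\<forall>T\<in>\<T>. \<exists>x. cball x (\<sigma> * Max (diameter ` \<T>)) \<subseteq> T)"


section \<open>Function spaces\<close>

text \<open>Elements of Lebesgue spaces are represented by functions; only their values almost
  everywhere in \<open>\<Omega>\<close> matter.\<close>

definition L2_space :: "(real ^ 'd) set \<Rightarrow> (real ^ 'd \<Rightarrow> real) set" where
  "L2_space \<Omega> = {q. q \<in> borel_measurable (lebesgue_on \<Omega>) \<and>
                     integrable (lebesgue_on \<Omega>) (\<lambda>x. (q x)\<^sup>2)}"

definition L2_norm :: "(real ^ 'd) set \<Rightarrow> (real ^ 'd \<Rightarrow> real) \<Rightarrow> real" where
  "L2_norm \<Omega> q = sqrt (LINT x|lebesgue_on \<Omega>. (q x)\<^sup>2)"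

definition L3_space :: "(real ^ 'd) set \<Rightarrow> (real ^ 'd \<Rightarrow> real ^ 'd) set" where
  "L3_space \<Omega> = {v. v \<in> borel_measurable (lebesgue_on \<Omega>) \<and>
                     integrable (lebesgue_on \<Omega>) (\<lambda>x. norm (v x) ^ 3)}"

definition L3_norm :: "(real ^ 'd) set \<Rightarrow> (real ^ 'd \<Rightarrow> real ^ 'd) \<Rightarrow> real" where
  "L3_norm \<Omega> v = root 3 (LINT x|lebesgue_on \<Omega>. norm (v x) ^ 3)"

definition grad :: "(real ^ 'd \<Rightarrow> real) \<Rightarrow> real ^ 'd \<Rightarrow> real ^ 'd" where
  "grad \<phi> x = (\<chi> i. frechet_derivative \<phi> (at x) (axis i 1))"

primrec Ck :: "nat \<Rightarrow> (real ^ 'd \<Rightarrow> real) \<Rightarrow> bool" where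
  "Ck 0 \<phi> \<longleftrightarrow> continuous_on UNIV \<phi>"
| "Ck (Suc k) \<phi> \<longleftrightarrow> (\<forall>x. \<phi> differentiable (at x)) \<and> (\<forall>i. Ck k (\<lambda>x. grad \<phi> x $ i))"

definition test_function :: "(real ^ 'd) set \<Rightarrow> (real ^ 'd \<Rightarrow> real) \<Rightarrow> bool" where
  "test_function \<Omega> \<phi> \<longleftrightarrow>
     (\<forall>k. Ck k \<phi>) \<and> compact (closure {x. \<phi> x \<noteq> 0}) \<and> closure {x. \<phi> x \<noteq> 0} \<subseteq> \<Omega>"

definition is_weak_div ::
    "(real ^ 'd) set \<Rightarrow> (real ^ 'd \<Rightarrow> real ^ 'd) \<Rightarrow> (real ^ 'd \<Rightarrow> real) \<Rightarrow> bool" where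
  "is_weak_div \<Omega> v w \<longleftrightarrow>
     (\<forall>\<phi>. test_function \<Omega> \<phi> \<longrightarrow>
        (LINT x|lebesgue_on \<Omega>. v x \<bullet> grad \<phi> x) = - (LINT x|lebesgue_on \<Omega>. w x * \<phi> x))"

definition X_space :: "(real ^ 'd) set \<Rightarrow> (real ^ 'd \<Rightarrow> real ^ 'd) set" where
  "X_space \<Omega> = {v \<in> L3_space \<Omega>. \<exists>w \<in> L2_space \<Omega>. is_weak_div \<Omega> v w}"

text \<open>A representative of the weak divergence, which is unique up to null sets.\<close>

definition wdiv :: "(real ^ 'd) set \<Rightarrow> (real ^ 'd \<Rightarrow> real ^ 'd) \<Rightarrow> real ^ 'd \<Rightarrow> real" where
  "wdiv \<Omega> v = (SOME w. w \<in> L2_space \<Omega> \<and> is_weak_div \<Omega> v w)"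

definition X_norm :: "(real ^ 'd) set \<Rightarrow> (real ^ 'd \<Rightarrow> real ^ 'd) \<Rightarrow> real" where
  "X_norm \<Omega> v = L3_norm \<Omega> v + L2_norm \<Omega> (wdiv \<Omega> v)"


section \<open>Data\<close>

definition Linfty_matrix :: "(real ^ 'd) set \<Rightarrow> (real ^ 'd \<Rightarrow> real ^ 'd ^ 'd) \<Rightarrow> bool" where
  "Linfty_matrix \<Omega> A \<longleftrightarrow>
     A \<in> borel_measurable (lebesgue_on \<Omega>) \<and>
     (\<exists>C. AE x in lebesgue_on \<Omega>. norm (A x) \<le> C)"

definition uniformly_pos_def :: "(real ^ 'd) set \<Rightarrow> (real ^ 'd \<Rightarrow> real ^ 'd ^ 'd) \<Rightarrow> bool" where
  "uniformly_pos_def \<Omega> A \<longleftrightarrow>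
     (\<exists>c>0. AE x in lebesgue_on \<Omega>. \<forall>\<xi>. (A x *v \<xi>) \<bullet> \<xi> \<ge> c * (norm \<xi>)\<^sup>2)"

definition permeability_tensor :: "(real ^ 'd) set \<Rightarrow> (real ^ 'd \<Rightarrow> real ^ 'd ^ 'd) \<Rightarrow> bool" where
  "permeability_tensor \<Omega> K \<longleftrightarrow>
     (AE x in lebesgue_on \<Omega>. transpose (K x) = K x) \<and>
     Linfty_matrix \<Omega> K \<and> uniformly_pos_def \<Omega> K \<and>
     Linfty_matrix \<Omega> (\<lambda>x. matrix_inv (K x)) \<and> uniformly_pos_def \<Omega> (\<lambda>x. matrix_inv (K x))"

text \<open>Integrability is required explicitly because the integral of a non-integrable function
  is \<open>0\<close> by convention; with it, linearity of the functional is automatic.\<close>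

definition bounded_load :: "(real ^ 'd) set \<Rightarrow> (real ^ 'd \<Rightarrow> real ^ 'd) \<Rightarrow> bool" where
  "bounded_load \<Omega> f \<longleftrightarrow>
     (\<forall>v\<in>X_space \<Omega>. integrable (lebesgue_on \<Omega>) (\<lambda>x. f x \<bullet> v x)) \<and>
     (\<exists>C. \<forall>v\<in>X_space \<Omega>. \<bar>LINT x|lebesgue_on \<Omega>. f x \<bullet> v x\<bar> \<le> C * X_norm \<Omega> v)"


section \<open>Mixed finite element spaces\<close>

definition fn_span :: "('a \<Rightarrow> 'b::real_vector) set \<Rightarrow> ('a \<Rightarrow> 'b) set" where
  "fn_span B = {v. \<exists>c. v = (\<lambda>x. \<Sum>b\<in>B. c b *\<^sub>R b x)}"

definition local_polynomial_space ::
    "('a::real_normed_vector \<Rightarrow> 'b::real_normed_vector) set \<Rightarrow> bool" where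
  "local_polynomial_space S \<longleftrightarrow>
     (\<exists>B. finite B \<and> S = fn_span B) \<and> (\<forall>v\<in>S. polynomial_function v)"

definition fe_velocity_space ::
    "(real ^ 'd) set \<Rightarrow> (real ^ 'd) set set \<Rightarrow> ((real ^ 'd) set \<Rightarrow> (real ^ 'd \<Rightarrow> real ^ 'd) set)
      \<Rightarrow> (real ^ 'd \<Rightarrow> real ^ 'd) set" where
  "fe_velocity_space \<Omega> \<T> XT =
     {v \<in> X_space \<Omega>. \<forall>T\<in>\<T>. \<exists>w\<in>XT T. AE x in lebesgue_on \<Omega>. x \<in> T \<longrightarrow> v x = w x}"

definition fe_pressure_space ::
    "(real ^ 'd) set \<Rightarrow> (real ^ 'd) set set \<Rightarrow> ((real ^ 'd) set \<Rightarrow> (real ^ 'd \<Rightarrow> real) set)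
      \<Rightarrow> (real ^ 'd \<Rightarrow> real) set" where
  "fe_pressure_space \<Omega> \<T> MT =
     {q \<in> L2_space \<Omega>. \<forall>T\<in>\<T>. \<exists>r\<in>MT T. AE x in lebesgue_on \<Omega>. x \<in> T \<longrightarrow> q x = r x}"

text \<open>A Raviart--Thomas-type pair is a conforming pair built from local polynomial spaces
  \<open>X\<^sub>h(T)\<close>, \<open>M\<^sub>h(T)\<close> (such as \<open>Q\<^bsub>k+1,k\<^esub> \<oplus> Q\<^bsub>k,k+1\<^esub>\<close>, \<open>Q\<^bsub>k,k\<^esub>\<close> on rectangles) for which
  \<open>div X\<^sub>h = M\<^sub>h\<close> as spaces of classes of functions modulo null sets.\<close>

definition RT_type_pair ::
    "(real ^ 'd) set \<Rightarrow> (real ^ 'd) set set \<Rightarrow>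
     (real ^ 'd \<Rightarrow> real ^ 'd) set \<Rightarrow> (real ^ 'd \<Rightarrow> real) set \<Rightarrow> bool" where
  "RT_type_pair \<Omega> \<T> Xh Mh \<longleftrightarrow>
     (\<exists>XT MT.
        (\<forall>T\<in>\<T>. local_polynomial_space (XT T) \<and> local_polynomial_space (MT T)) \<and>
        Xh = fe_velocity_space \<Omega> \<T> XT \<and> Mh = fe_pressure_space \<Omega> \<T> MT) \<and>
     (\<forall>v\<in>Xh. wdiv \<Omega> v \<in> Mh) \<and>
     (\<forall>q\<in>Mh. \<exists>v\<in>Xh. AE x in lebesgue_on \<Omega>. wdiv \<Omega> v x = q x)"

definition is_L2_projection ::
    "(real ^ 'd) set \<Rightarrow> (real ^ 'd \<Rightarrow> real) set \<Rightarrow> (real ^ 'd \<Rightarrow> real) \<Rightarrow> (real ^ 'd \<Rightarrow> real) \<Rightarrow> bool"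
  where
  "is_L2_projection \<Omega> Mh g gh \<longleftrightarrow>
     gh \<in> Mh \<and> (\<forall>q\<in>Mh. (LINT x|lebesgue_on \<Omega>. (g x - gh x) * q x) = 0)"


section \<open>Discrete Darcy--Forchheimer problem and augmented Lagrangian method\<close>

definition discrete_DF_solution ::
    "(real ^ 'd) set \<Rightarrow> real \<Rightarrow> real \<Rightarrow> real \<Rightarrow> (real ^ 'd \<Rightarrow> real ^ 'd ^ 'd) \<Rightarrow>
     (real ^ 'd \<Rightarrow> real ^ 'd) \<Rightarrow> (real ^ 'd \<Rightarrow> real) \<Rightarrow>
     (real ^ 'd \<Rightarrow> real ^ 'd) set \<Rightarrow> (real ^ 'd \<Rightarrow> real) set \<Rightarrow>
     (real ^ 'd \<Rightarrow> real ^ 'd) \<Rightarrow> (real ^ 'd \<Rightarrow> real) \<Rightarrow> bool" where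
  "discrete_DF_solution \<Omega> \<mu> \<rho> \<beta> K f g Xh Mh uh ph \<longleftrightarrow>
     uh \<in> Xh \<and> ph \<in> Mh \<and>
     (\<forall>v\<in>Xh.
        \<mu> / \<rho> * (LINT x|lebesgue_on \<Omega>. (matrix_inv (K x) *v uh x) \<bullet> v x)
        + \<beta> / \<rho> * (LINT x|lebesgue_on \<Omega>. (norm (uh x) *\<^sub>R uh x) \<bullet> v x)
        - (LINT x|lebesgue_on \<Omega>. ph x * wdiv \<Omega> v x)
        = (LINT x|lebesgue_on \<Omega>. f x \<bullet> v x)) \<and>
     (\<forall>q\<in>Mh. (LINT x|lebesgue_on \<Omega>. q x * wdiv \<Omega> uh x) = (LINT x|lebesgue_on \<Omega>. g x * q x))"

definition DF_energy ::
    "(real ^ 'd) set \<Rightarrow> real \<Rightarrow> real \<Rightarrow> real \<Rightarrow> (real ^ 'd \<Rightarrow> real ^ 'd ^ 'd) \<Rightarrow>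
     (real ^ 'd \<Rightarrow> real ^ 'd) \<Rightarrow> (real ^ 'd \<Rightarrow> real ^ 'd) \<Rightarrow> real" where
  "DF_energy \<Omega> \<mu> \<rho> \<beta> K f v =
     \<mu> / (2 * \<rho>) * (LINT x|lebesgue_on \<Omega>. (matrix_inv (K x) *v v x) \<bullet> v x)
     + \<beta> / (3 * \<rho>) * (LINT x|lebesgue_on \<Omega>. norm (v x) ^ 3)
     - (LINT x|lebesgue_on \<Omega>. f x \<bullet> v x)"

definition gateaux_deriv ::
    "(('a \<Rightarrow> 'b::real_vector) \<Rightarrow> real) \<Rightarrow> ('a \<Rightarrow> 'b) \<Rightarrow> ('a \<Rightarrow> 'b) \<Rightarrow> real" where
  "gateaux_deriv F v w = deriv (\<lambda>t. F (\<lambda>x. v x + t *\<^sub>R w x)) 0"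

definition bregman_sym ::
    "(('a \<Rightarrow> 'b::real_vector) \<Rightarrow> real) \<Rightarrow> ('a \<Rightarrow> 'b) \<Rightarrow> ('a \<Rightarrow> 'b) \<Rightarrow> real" where
  "bregman_sym F v w =
     gateaux_deriv F v (\<lambda>x. v x - w x) - gateaux_deriv F w (\<lambda>x. v x - w x)"

text \<open>The velocity iterates start at index \<open>1\<close>; \<open>u 0\<close> is unconstrained and never used.\<close>

definition ALM_sequence ::
    "(real ^ 'd) set \<Rightarrow> ((real ^ 'd \<Rightarrow> real ^ 'd) \<Rightarrow> real) \<Rightarrow> (real ^ 'd \<Rightarrow> real ^ 'd) set \<Rightarrow>
     (real ^ 'd \<Rightarrow> real) \<Rightarrow> real \<Rightarrow> (real ^ 'd \<Rightarrow> real) \<Rightarrow>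
     (nat \<Rightarrow> real ^ 'd \<Rightarrow> real ^ 'd) \<Rightarrow> (nat \<Rightarrow> real ^ 'd \<Rightarrow> real) \<Rightarrow> bool" where
  "ALM_sequence \<Omega> F Xh gh \<epsilon> p0 u p \<longleftrightarrow>
     p 0 = p0 \<and>
     (\<forall>n.
        is_arg_min
          (\<lambda>v. F v - (LINT x|lebesgue_on \<Omega>. p n x * wdiv \<Omega> v x)
               + 1 / (2 * \<epsilon>) * (LINT x|lebesgue_on \<Omega>. (wdiv \<Omega> v x - gh x)\<^sup>2))
          (\<lambda>v. v \<in> Xh) (u (Suc n)) \<and>
        (AE x in lebesgue_on \<Omega>.
           p (Suc n) x = p n x - inverse \<epsilon> * (wdiv \<Omega> (u (Suc n)) x - gh x)))"

end

theory Submission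
  imports Defs
begin

text \<open>
  Write \<open>e\<^sub>n = p\<^sub>n - p\<^sub>h\<close>. The optimality condition of the minimisation step is
  \<open>\<langle>F'(u\<^sub>n\<^sub>+\<^sub>1) - F'(u\<^sub>h), v\<rangle> = (e\<^sub>n\<^sub>+\<^sub>1, div v)\<close> for all discrete velocities \<open>v\<close>. Since
  \<open>div (u\<^sub>n\<^sub>+\<^sub>1 - u\<^sub>h) = \<epsilon> (e\<^sub>n - e\<^sub>n\<^sub>+\<^sub>1)\<close>, the symmetrised Bregman divergence \<open>D\<close> equals
  \<open>\<epsilon> (e\<^sub>n\<^sub>+\<^sub>1, e\<^sub>n - e\<^sub>n\<^sub>+\<^sub>1)\<close>, which is at most \<open>\<epsilon>/4 \<parallel>e\<^sub>n\<parallel>\<^sup>2\<close>. If moreover \<open>D \<ge> m \<parallel>e\<^sub>n\<^sub>+\<^sub>1\<parallel>\<^sup>2\<close>, then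
  Cauchy--Schwarz gives the contraction \<open>\<parallel>e\<^sub>n\<^sub>+\<^sub>1\<parallel> \<le> \<epsilon>/(m + \<epsilon>) \<parallel>e\<^sub>n\<parallel>\<close>.

  For such an \<open>m\<close>, independent of \<open>\<epsilon>\<close>: \<open>D \<ge> c \<parallel>w\<parallel>\<^sup>2\<close> with \<open>w = u\<^sub>n\<^sub>+\<^sub>1 - u\<^sub>h\<close>. Because \<open>div X\<^sub>h = M\<^sub>h\<close> is
  finite-dimensional, \<open>\<parallel>e\<^sub>n\<^sub>+\<^sub>1\<parallel>\<close> is controlled by finitely many numbers \<open>(e\<^sub>n\<^sub>+\<^sub>1, div v\<^sub>j)\<close>, hence by
  \<open>\<parallel>w\<parallel> + \<parallel>w\<parallel>\<^sup>2\<close>. For \<open>\<parallel>w\<parallel> \<le> 1\<close> this suffices; for \<open>\<parallel>w\<parallel> > 1\<close> one uses \<open>D \<ge> c\<close> and the fact that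
  \<open>\<parallel>e\<^sub>n\<parallel>\<close> never exceeds \<open>\<parallel>e\<^sub>0\<parallel>\<close>.
\<close>

section \<open>Smooth bump functions\<close>

text \<open>For \<open>m = 0\<close> this is the classical smooth function that is flat at the
  origin. The extra factor \<open>1 / t ^ m\<close> makes the family, up to linear combinations,
  closed under differentiation.\<close>

definition flat_exp :: "nat \<Rightarrow> real \<Rightarrow> real" where
  "flat_exp m t = (if t > 0 then exp (- 1 / t) / t ^ m else 0)"

text \<open>Away from 0 this is the quotient rule. At 0 both sides vanish, because the exponential
  decays faster than any power of \<open>1 / t\<close> grows.\<close>

lemma flat_exp_has_derivative:
  "(flat_exp m has_real_derivative flat_exp (m + 2) t - real m * flat_exp (m + 1) t) (at t)"
proof -
  consider "t > 0" | "t < 0" | "t = 0" by linarith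
  then show ?thesis
  proof cases
    case 1
    have "((\<lambda>t. exp (- 1 / t) / t ^ m) has_real_derivative
        (exp (- 1 / t) * (1 / t\<^sup>2) * t ^ m - exp (- 1 / t) * (real m * t ^ (m - 1))) / (t ^ m * t ^ m)) (at t)"
      using 1 by (auto intro!: derivative_eq_intros simp: power2_eq_square)
    moreover have "(exp (- 1 / t) * (1 / t\<^sup>2) * t ^ m - exp (- 1 / t) * (real m * t ^ (m - 1))) / (t ^ m * t ^ m)
        = flat_exp (m + 2) t - real m * flat_exp (m + 1) t"
      \<comment> \<open>The case \<open>m = 0\<close> is separate because of the truncated exponent
        in \<open>t ^ (m - 1)\<close>; there the factor \<open>real m\<close> removes the
        term.\<close>
      using 1 by (cases m) (auto simp: flat_exp_def field_simps power2_eq_square)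
    ultimately have "((\<lambda>t. exp (- 1 / t) / t ^ m) has_real_derivative
        flat_exp (m + 2) t - real m * flat_exp (m + 1) t) (at t)" by simp
    then show ?thesis
      by (rule has_field_derivative_transform_within_open[where S = "{0<..}"])
         (use 1 in \<open>auto simp: flat_exp_def\<close>)
  next
    case 2
    have "((\<lambda>t. 0) has_real_derivative 0) (at t)" by simp
    then have "(flat_exp m has_real_derivative 0) (at t)"
      by (rule has_field_derivative_transform_within_open[where S = "{..<0}"])
         (use 2 in \<open>auto simp: flat_exp_def\<close>)
    then show ?thesis using 2 by (simp add: flat_exp_def)
  next
    case 3
    have "((\<lambda>y. (flat_exp m y - flat_exp m 0) / (y - 0)) \<longlongrightarrow> 0) (at 0)"
    proof (rule filterlim_split_at)
      show "((\<lambda>y. (flat_exp m y - flat_exp m 0) / (y - 0)) \<longlongrightarrow> 0) (at_left 0)"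
        by (rule tendsto_eventually)
           (auto simp: flat_exp_def eventually_at_filter)
      \<comment> \<open>The substitution \<open>z = inverse y\<close> turns the right-hand limit
        into \<open>z ^ (m + 1) / exp z\<close> at infinity.\<close>
      have "((\<lambda>y::real. exp (- 1 / y) / y ^ m / y) \<longlongrightarrow> 0) (at_right 0)"
      proof -
        have "((\<lambda>z::real. z ^ (m + 1) / exp z) \<longlongrightarrow> 0) at_top"
          by (rule tendsto_power_div_exp_0)
        then have "((\<lambda>y::real. inverse y ^ (m + 1) / exp (inverse y)) \<longlongrightarrow> 0) (at_right 0)"
          by (rule filterlim_compose) (rule filterlim_inverse_at_top_right)
        then show ?thesis by (simp add: exp_minus field_simps)
      qed
      then show "((\<lambda>y. (flat_exp m y - flat_exp m 0) / (y - 0)) \<longlongrightarrow> 0) (at_right 0)"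
        by (rule tendsto_cong[THEN iffD1, rotated])
           (auto simp: flat_exp_def eventually_at_filter)
    qed
    then show ?thesis using 3 by (simp add: has_field_derivative_iff flat_exp_def)
  qed
qed

lemma grad_eqI:
  assumes "(\<phi> has_derivative D) (at x)"
  shows "grad \<phi> x $ i = D (axis i 1)"
  using frechet_derivative_at[OF assms] by (simp add: grad_def)

text \<open>An algebra of functions that contains the standard bump function and is closed under
  partial derivatives, so that its members are automatically smooth.\<close>

inductive_set bump_algebra :: "real \<Rightarrow> real ^ 'd \<Rightarrow> (real ^ 'd \<Rightarrow> real) set"
  for r :: real and a :: "real ^ 'd" where
  const: "(\<lambda>x. c) \<in> bump_algebra r a"
| coord: "(\<lambda>x. x $ i) \<in> bump_algebra r a"
| flat: "(\<lambda>x. flat_exp m (r\<^sup>2 - (x - a) \<bullet> (x - a))) \<in> bump_algebra r a"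
| add: "f \<in> bump_algebra r a \<Longrightarrow> g \<in> bump_algebra r a \<Longrightarrow> (\<lambda>x. f x + g x) \<in> bump_algebra r a"
| mult: "f \<in> bump_algebra r a \<Longrightarrow> g \<in> bump_algebra r a \<Longrightarrow> (\<lambda>x. f x * g x) \<in> bump_algebra r a"

text \<open>Only the generator \<open>flat\<close> needs thought: by the chain rule its partial
  derivatives are an affine coordinate factor times members of the family with exponents
  \<open>m + 1\<close> and \<open>m + 2\<close>.\<close>

lemma bump_algebra_derivative:
  assumes "\<phi> \<in> bump_algebra r a"
  shows "\<exists>D. (\<forall>x. (\<phi> has_derivative D x) (at x)) \<and> (\<forall>i. (\<lambda>x. D x (axis i 1)) \<in> bump_algebra r a)"
  using assms
proof induction
  case (const c)
  show ?case by (rule exI[where x = "\<lambda>x h. 0"]) (auto intro: bump_algebra.intros)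
next
  case (coord j)
  show ?case
    by (rule exI[where x = "\<lambda>x h. h $ j"])
       (auto intro!: bump_algebra.intros bounded_linear_imp_has_derivative bounded_linear_vec_nth)
next
  case (flat m)
  define s where "s x = r\<^sup>2 - (x - a) \<bullet> (x - a)" for x
  define dm where "dm t = flat_exp (m + 2) t - real m * flat_exp (m + 1) t" for t
  have s: "(s has_derivative (\<lambda>h. - 2 * ((x - a) \<bullet> h))) (at x)" for x
    unfolding s_def by (auto intro!: derivative_eq_intros simp: inner_commute)
  have "((\<lambda>x. flat_exp m (s x)) has_derivative (\<lambda>h. - 2 * ((x - a) \<bullet> h) * dm (s x))) (at x)" for x
  proof -
    have "(flat_exp m has_derivative (\<lambda>h. h * dm (s x))) (at (s x))"
      using flat_exp_has_derivative[of m "s x"]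
      by (simp add: dm_def has_field_derivative_def mult_commute_abs)
    from has_derivative_compose[OF s this] show ?thesis .
  qed
  moreover have "(\<lambda>x. - 2 * ((x - a) \<bullet> axis i 1) * dm (s x)) \<in> bump_algebra r a" for i
  proof -
    \<comment> \<open>Differences are written as sums with constant multiples, so that the
      introduction rules of the algebra apply literally.\<close>
    have "(\<lambda>x. (- 2 * (x $ i + (- (a $ i)))) *
        (flat_exp (m + 2) (r\<^sup>2 - (x - a) \<bullet> (x - a)) + (- real m) * flat_exp (m + 1) (r\<^sup>2 - (x - a) \<bullet> (x - a))))
        \<in> bump_algebra r a"
      by (intro bump_algebra.intros)
    then show ?thesis by (simp add: dm_def s_def inner_axis algebra_simps)
  qed
  ultimately show ?case
    by (intro exI[where x = "\<lambda>x h. - 2 * ((x - a) \<bullet> h) * dm (s x)"]) (simp add: s_def)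
next
  case (add f g)
  then obtain D E where "\<And>x. (f has_derivative D x) (at x)" "\<And>x. (g has_derivative E x) (at x)"
    "\<And>i. (\<lambda>x. D x (axis i 1)) \<in> bump_algebra r a" "\<And>i. (\<lambda>x. E x (axis i 1)) \<in> bump_algebra r a"
    by blast
  then show ?case
    by (intro exI[where x = "\<lambda>x h. D x h + E x h"]) (auto intro: bump_algebra.intros has_derivative_add)
next
  case (mult f g)
  then obtain D E where "\<And>x. (f has_derivative D x) (at x)" "\<And>x. (g has_derivative E x) (at x)"
    "\<And>i. (\<lambda>x. D x (axis i 1)) \<in> bump_algebra r a" "\<And>i. (\<lambda>x. E x (axis i 1)) \<in> bump_algebra r a"
    by blast
  then show ?case using mult.hyps
    by (intro exI[where x = "\<lambda>x h. f x * E x h + D x h * g x"])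
       (intro conjI allI has_derivative_mult bump_algebra.add bump_algebra.mult)
qed

lemma bump_algebra_Ck:
  assumes "\<phi> \<in> bump_algebra r a"
  shows "Ck k \<phi>"
  using assms
proof (induction k arbitrary: \<phi>)
  case 0
  then show ?case
    using bump_algebra_derivative[OF 0]
    by (auto intro!: continuous_at_imp_continuous_on intro: has_derivative_continuous)
next
  case (Suc k)
  from bump_algebra_derivative[OF Suc.prems] obtain D where
    D: "\<And>x. (\<phi> has_derivative D x) (at x)" and alg: "\<And>i. (\<lambda>x. D x (axis i 1)) \<in> bump_algebra r a"
    by blast
  then show ?case
    using Suc.IH[OF alg] by (auto simp: differentiable_def grad_eqI[OF D])
qed

text \<open>Test functions positive exactly on a prescribed ball are what later identifies a
  discrete function from its integrals. The witness composes \<open>flat_exp 0\<close> with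
  \<open>r\<^sup>2 - norm (x - a)\<^sup>2\<close>.\<close>

lemma exists_bump_function:
  fixes a :: "real ^ 'd"
  assumes "r > 0" and "cball a r \<subseteq> \<Omega>"
  obtains \<phi> where "test_function \<Omega> \<phi>" and "\<And>x. x \<in> ball a r \<Longrightarrow> \<phi> x > 0"
    and "\<And>x. x \<notin> ball a r \<Longrightarrow> \<phi> x = 0"
proof
  define \<phi> where "\<phi> x = flat_exp 0 (r\<^sup>2 - (x - a) \<bullet> (x - a))" for x
  have *: "r\<^sup>2 - (x - a) \<bullet> (x - a) > 0 \<longleftrightarrow> x \<in> ball a r" for x
    using \<open>r > 0\<close> by (simp add: dist_norm norm_minus_commute power2_norm_eq_inner[symmetric]
        abs_le_square_iff[symmetric] not_le[symmetric])
  show pos: "\<phi> x > 0" if "x \<in> ball a r" for x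
    using that * by (simp add: \<phi>_def flat_exp_def)
  show zero: "\<phi> x = 0" if "x \<notin> ball a r" for x
    using that * by (simp add: \<phi>_def flat_exp_def)
  have "closure {x. \<phi> x \<noteq> 0} \<subseteq> cball a r"
    by (rule closure_minimal) (use zero in force)+
  moreover have "Ck k \<phi>" for k
    unfolding \<phi>_def by (rule bump_algebra_Ck) (rule bump_algebra.flat)
  ultimately show "test_function \<Omega> \<phi>"
    using assms(2) bounded_subset[OF bounded_cball] by (auto simp: test_function_def compact_eq_bounded_closed)
qed

section \<open>Algebraic inequalities\<close>

text \<open>In spectral terms this is \<open>G \<le> C * G\<^sup>2\<close>, with \<open>C\<close>
  the reciprocal of the smallest positive eigenvalue. The kernel is harmless since both sides vanish
  on it, so a Gram matrix of linearly dependent vectors is admissible.\<close>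

lemma psd_gram_bound:
  fixes G :: "'j \<Rightarrow> 'j \<Rightarrow> real"
  assumes "finite J" and "\<And>i j. G i j = G j i"
    and "\<And>c. 0 \<le> (\<Sum>j\<in>J. c j * (\<Sum>i\<in>J. c i * G i j))"
  shows "\<exists>C\<ge>0. \<forall>c. (\<Sum>j\<in>J. c j * (\<Sum>i\<in>J. c i * G i j)) \<le> C * (\<Sum>j\<in>J. (\<Sum>i\<in>J. c i * G i j)\<^sup>2)"
  using assms
proof (induction J arbitrary: G rule: finite_induct)
  \<comment> \<open>Eliminate one index by passing to the Schur complement, which is again positive semidefinite.\<close>
  case empty
  then show ?case by auto
next
  case (insert s J)
  note sym = insert.prems(1) and psd = insert.prems(2) and [simp] = insert.hyps
  define r where "r c j = (\<Sum>i\<in>insert s J. c i * G i j)" for c j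
  define H where "H i j = G i j - G i s * G j s / G s s" for i j
  have r_split: "r c j = c s * G s j + (\<Sum>i\<in>J. c i * G i j)" for c j
    by (simp add: r_def)
  have psd': "0 \<le> c s * r c s + (\<Sum>j\<in>J. c j * r c j)" for c
    using psd[of c] by (simp add: r_def)
  show ?case
  proof (cases "G s s = 0")
    case True
    have row: "G s j = 0" if "j \<in> J" for j
    proof (rule ccontr)
      assume nz: "G s j \<noteq> 0"
      \<comment> \<open>With zero pivot, the form at the j-th unit vector plus \<open>t\<close>
        times the s-th is \<open>2 * t * G s j + G j j\<close>; this \<open>t\<close> makes it -1,
        contradicting semidefiniteness. Hence a zero pivot forces a zero row.\<close>
      define t where "t = - (G j j + 1) / (2 * G s j)"
      define c where "c = (\<lambda>i. if i = j then 1 else if i = s then t else (0::real))"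
      have "j \<noteq> s" using that insert.hyps by auto
      have S: "(\<Sum>i\<in>J. c i * h i) = h j" for h
      proof -
        have "(\<Sum>i\<in>J. c i * h i) = (\<Sum>i\<in>J. if i = j then h j else 0)"
          by (rule sum.cong) (use insert.hyps in \<open>auto simp: c_def\<close>)
        then show ?thesis using that by simp
      qed
      have "0 \<le> t * G s j + (t * G s j + G j j)"
        using psd'[of c] True S \<open>j \<noteq> s\<close> sym[of j s] by (simp add: r_split c_def[THEN fun_cong, of s])
      moreover have "2 * (t * G s j) = - (G j j + 1)"
        using nz by (simp add: t_def)
      ultimately show False by linarith
    qed
    have rs: "r c s = 0" for c
    proof -
      have "(\<Sum>i\<in>J. c i * G i s) = 0"
        by (rule sum.neutral) (metis row sym mult_zero_right)
      then show ?thesis using True by (simp add: r_split)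
    qed
    have rj: "r c j = (\<Sum>i\<in>J. c i * G i j)" if "j \<in> J" for c j
      using row[OF that] by (simp add: r_split)
    have "0 \<le> (\<Sum>j\<in>J. c j * (\<Sum>i\<in>J. c i * G i j))" for c
      using psd'[of c] rs rj by simp
    then obtain C where "C \<ge> 0" and
      C: "\<And>c. (\<Sum>j\<in>J. c j * (\<Sum>i\<in>J. c i * G i j)) \<le> C * (\<Sum>j\<in>J. (\<Sum>i\<in>J. c i * G i j)\<^sup>2)"
      using insert.IH[of G] sym by blast
    then show ?thesis
      unfolding r_def[symmetric] using rs rj by (intro exI[of _ C]) simp
  next
    case False
    have "G s s \<ge> 0"
    proof -
      define c where "c = (\<lambda>i. if i = s then 1 else (0::real))"
      have "(\<Sum>i\<in>J. c i * h i) = 0" for h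
        by (rule sum.neutral) (use insert.hyps in \<open>auto simp: c_def\<close>)
      then show ?thesis using psd'[of c] by (simp add: r_split) (simp add: c_def)
    qed
    then have pos: "G s s > 0" using False by simp
    have rH: "(\<Sum>i\<in>J. c i * H i j) = r c j - G j s * r c s / G s s" for c j
    proof -
      have "(\<Sum>i\<in>J. c i * H i j) = (\<Sum>i\<in>J. c i * G i j) - G j s / G s s * (\<Sum>i\<in>J. c i * G i s)"
        by (simp add: H_def sum_distrib_left sum_subtractf[symmetric] algebra_simps)
      then show ?thesis using False sym[of s j] by (simp add: r_split field_simps)
    qed
    \<comment> \<open>Completing the square in the coordinate \<open>s\<close>: the reduced form is
      the full form minus the square carried by the pivot.\<close>
    have qH: "(\<Sum>j\<in>J. c j * (\<Sum>i\<in>J. c i * H i j))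
        = (c s * r c s + (\<Sum>j\<in>J. c j * r c j)) - (r c s)\<^sup>2 / G s s" for c
    proof -
      have "(\<Sum>j\<in>J. c j * (\<Sum>i\<in>J. c i * H i j))
          = (\<Sum>j\<in>J. c j * r c j) - (\<Sum>j\<in>J. c j * G j s) * (r c s / G s s)"
        by (simp add: rH right_diff_distrib sum_subtractf sum_distrib_right sum_divide_distrib mult.assoc)
      moreover have "(\<Sum>j\<in>J. c j * G j s) = r c s - c s * G s s"
        by (simp add: r_split)
      ultimately show ?thesis using False by (simp add: field_simps power2_eq_square)
    qed
    have "0 \<le> (\<Sum>j\<in>J. c j * (\<Sum>i\<in>J. c i * H i j))" for c
    proof -
      \<comment> \<open>The coordinate \<open>s\<close> is free in the reduced form. Choosing it so
        that \<open>r d s = 0\<close> makes the reduced form equal to the full one, which is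
        nonnegative.\<close>
      define d where "d = c(s := - (\<Sum>i\<in>J. c i * G i s) / G s s)"
      have d: "(\<Sum>i\<in>J. d i * h i) = (\<Sum>i\<in>J. c i * h i)" for h
        by (rule sum.cong) (use insert.hyps in \<open>auto simp: d_def\<close>)
      have "r d s = 0"
        using False d[of "\<lambda>i. G i s"] by (simp add: r_split) (simp add: d_def)
      then show ?thesis using qH[of d] psd'[of d] by (simp add: d)
    qed
    moreover have "H i j = H j i" for i j
      using sym[of i j] by (simp add: H_def)
    ultimately obtain C where "C \<ge> 0" and
      C: "\<And>c. (\<Sum>j\<in>J. c j * (\<Sum>i\<in>J. c i * H i j)) \<le> C * (\<Sum>j\<in>J. (\<Sum>i\<in>J. c i * H i j)\<^sup>2)"
      using insert.IH[of H] by blast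
    define S where "S = (\<Sum>j\<in>J. (G j s / G s s)\<^sup>2)"
    have "S \<ge> 0" by (simp add: S_def sum_nonneg)
    \<comment> \<open>In the constant, \<open>2 * C\<close> and \<open>2 * C * S\<close> come from
      bounding the square of a difference by twice the sum of squares, \<open>S\<close> measuring
      the pivot column; \<open>1 / G s s\<close> pays for the square split off by
      \<open>qH\<close>.\<close>
    have "c s * r c s + (\<Sum>j\<in>J. c j * r c j)
        \<le> (2 * C + 2 * C * S + 1 / G s s) * ((r c s)\<^sup>2 + (\<Sum>j\<in>J. (r c j)\<^sup>2))" for c
    proof -
      have "(\<Sum>j\<in>J. (\<Sum>i\<in>J. c i * H i j)\<^sup>2) \<le> (\<Sum>j\<in>J. 2 * (r c j)\<^sup>2 + 2 * (r c s)\<^sup>2 * (G j s / G s s)\<^sup>2)"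
      proof (rule sum_mono)
        fix j
        show "(\<Sum>i\<in>J. c i * H i j)\<^sup>2 \<le> 2 * (r c j)\<^sup>2 + 2 * (r c s)\<^sup>2 * (G j s / G s s)\<^sup>2"
          unfolding rH using zero_le_power2[of "r c j + G j s * r c s / G s s"]
          by (simp add: power2_diff power2_sum power_mult_distrib power_divide field_simps)
      qed
      also have "\<dots> = 2 * (\<Sum>j\<in>J. (r c j)\<^sup>2) + 2 * (r c s)\<^sup>2 * S"
        by (simp add: S_def sum.distrib sum_distrib_left)
      finally have "C * (\<Sum>j\<in>J. (\<Sum>i\<in>J. c i * H i j)\<^sup>2)
          \<le> C * (2 * (\<Sum>j\<in>J. (r c j)\<^sup>2) + 2 * (r c s)\<^sup>2 * S)"
        using \<open>C \<ge> 0\<close> by (rule mult_left_mono)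
      then have "c s * r c s + (\<Sum>j\<in>J. c j * r c j)
          \<le> C * (2 * (\<Sum>j\<in>J. (r c j)\<^sup>2) + 2 * (r c s)\<^sup>2 * S) + (r c s)\<^sup>2 / G s s"
        using C[of c] qH[of c] by linarith
      moreover have "0 \<le> (2 * C * S + 1 / G s s) * (\<Sum>j\<in>J. (r c j)\<^sup>2) + 2 * C * (r c s)\<^sup>2"
        using pos \<open>C \<ge> 0\<close> \<open>S \<ge> 0\<close> by (intro add_nonneg_nonneg mult_nonneg_nonneg sum_nonneg) auto
      ultimately show ?thesis by (simp add: algebra_simps)
    qed
    moreover have "0 \<le> 2 * C + 2 * C * S + 1 / G s s"
      using pos \<open>C \<ge> 0\<close> \<open>S \<ge> 0\<close> by simp
    ultimately show ?thesis
      unfolding r_def[symmetric] by (intro exI[of _ "2 * C + 2 * C * S + 1 / G s s"]) simp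
  qed
qed

section \<open>Pointwise inequalities for the Forchheimer term\<close>

text \<open>A first-order Taylor formula with explicit quadratic remainder that also covers
  \<open>a = 0\<close>, where the norm itself is not differentiable. It rests on an exact polynomial
  identity in the two norms, whose remainder contains only \<open>(m - n)\<^sup>2\<close> and
  \<open>t\<^sup>2 * k\<^sup>2\<close>.\<close>

lemma norm_cube_expansion:
  fixes a b :: "'a::real_inner"
  shows "\<bar>norm (a + t *\<^sub>R b) ^ 3 - norm a ^ 3 - 3 * t * (norm a * (a \<bullet> b))\<bar>
    \<le> t\<^sup>2 * ((norm b)\<^sup>2 * (3 * norm a + \<bar>t\<bar> * norm b))"
proof -
  define m where "m = norm (a + t *\<^sub>R b)"
  define n where "n = norm a"
  define k where "k = norm b"
  have nn: "m \<ge> 0" "n \<ge> 0" "k \<ge> 0" by (auto simp: m_def n_def k_def)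
  have sq: "m\<^sup>2 - n\<^sup>2 = 2 * t * (a \<bullet> b) + t\<^sup>2 * k\<^sup>2"
    unfolding m_def n_def k_def power2_norm_eq_inner
    by (simp add: inner_add_left inner_add_right inner_commute power2_eq_square algebra_simps)
  have mn: "\<bar>m - n\<bar> \<le> \<bar>t\<bar> * k"
    using norm_triangle_ineq3[of "a + t *\<^sub>R b" a] by (simp add: m_def n_def k_def)
  then have le: "(m - n)\<^sup>2 \<le> t\<^sup>2 * k\<^sup>2"
    using abs_le_square_iff[of "m - n" "t * k"] nn by (simp add: power_mult_distrib abs_mult)
  have id: "m ^ 3 - n ^ 3 - 3 * t * (n * (a \<bullet> b)) = (m - n)\<^sup>2 * (m + n / 2) + 3 / 2 * n * (t\<^sup>2 * k\<^sup>2)"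
  proof -
    have "m ^ 3 - n ^ 3 - 3 / 2 * n * (m\<^sup>2 - n\<^sup>2) = (m - n)\<^sup>2 * (m + n / 2)"
      by (simp add: power2_eq_square power3_eq_cube field_simps)
    moreover have "3 / 2 * n * (m\<^sup>2 - n\<^sup>2) = 3 * t * (n * (a \<bullet> b)) + 3 / 2 * n * (t\<^sup>2 * k\<^sup>2)"
      unfolding sq by (simp add: algebra_simps)
    ultimately show ?thesis by linarith
  qed
  have "(m - n)\<^sup>2 * (m + n / 2) \<le> t\<^sup>2 * k\<^sup>2 * (m + n / 2)"
    using le nn by (intro mult_right_mono) auto
  moreover have "t\<^sup>2 * k\<^sup>2 * (m + n / 2) \<le> t\<^sup>2 * k\<^sup>2 * (n + \<bar>t\<bar> * k + n / 2)"
    using mn by (intro mult_left_mono) auto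
  moreover have "0 \<le> (m - n)\<^sup>2 * (m + n / 2) + 3 / 2 * n * (t\<^sup>2 * k\<^sup>2)" using nn by simp
  ultimately have "\<bar>m ^ 3 - n ^ 3 - 3 * t * (n * (a \<bullet> b))\<bar> \<le> t\<^sup>2 * (k\<^sup>2 * (3 * n + \<bar>t\<bar> * k))"
    unfolding id by (simp add: algebra_simps)
  then show ?thesis by (simp add: m_def n_def k_def)
qed

text \<open>Applying Cauchy--Schwarz to the cross term leaves
  \<open>(norm a + norm b) * (norm a - norm b)\<^sup>2\<close> as a lower bound.\<close>

lemma norm_scale_monotone:
  fixes a b :: "'a::real_inner"
  shows "0 \<le> (norm a *\<^sub>R a - norm b *\<^sub>R b) \<bullet> (a - b)"
proof -
  have "(norm a *\<^sub>R a - norm b *\<^sub>R b) \<bullet> (a - b)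
      = norm a * (norm a)\<^sup>2 + norm b * (norm b)\<^sup>2 - (norm a + norm b) * (a \<bullet> b)"
    by (simp add: power2_norm_eq_inner inner_diff inner_commute algebra_simps)
  moreover have "(norm a + norm b) * (a \<bullet> b) \<le> (norm a + norm b) * (norm a * norm b)"
    by (intro mult_left_mono norm_cauchy_schwarz) auto
  moreover have "norm a * (norm a)\<^sup>2 + norm b * (norm b)\<^sup>2 - (norm a + norm b) * (norm a * norm b)
      = (norm a + norm b) * (norm a - norm b)\<^sup>2"
    by (simp add: power2_eq_square algebra_simps)
  moreover have "0 \<le> (norm a + norm b) * (norm a - norm b)\<^sup>2" by simp
  ultimately show ?thesis by linarith
qed

text \<open>The right side contains only \<open>b\<close> and the difference. With \<open>b\<close>
  fixed and bounded, no a priori bound on \<open>a\<close> is required, at the price of a quadratic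
  term.\<close>

lemma norm_scale_lipschitz:
  fixes a b :: "'a::real_normed_vector"
  shows "norm (norm a *\<^sub>R a - norm b *\<^sub>R b) \<le> 2 * norm b * norm (a - b) + (norm (a - b))\<^sup>2"
proof -
  have "norm a *\<^sub>R a - norm b *\<^sub>R b = norm a *\<^sub>R (a - b) + (norm a - norm b) *\<^sub>R b"
    by (simp add: algebra_simps)
  then have "norm (norm a *\<^sub>R a - norm b *\<^sub>R b) \<le> norm a * norm (a - b) + \<bar>norm a - norm b\<bar> * norm b"
    by (metis norm_triangle_ineq norm_scaleR abs_norm_cancel real_norm_def)
  also have "\<dots> \<le> (norm b + norm (a - b)) * norm (a - b) + norm (a - b) * norm b"
    by (intro add_mono mult_right_mono norm_triangle_sub norm_triangle_ineq3) auto
  finally show ?thesis by (simp add: algebra_simps power2_eq_square)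
qed

text \<open>Coercivity makes the kernel trivial, so \<open>matrix_inv K\<close> is a genuine
  two-sided inverse. Its transpose is then a left inverse of the symmetric \<open>K\<close>, and
  inverses are unique.\<close>

lemma transpose_matrix_inv_symmetric:
  fixes K :: "real ^ 'd ^ 'd"
  assumes "transpose K = K" and "c > 0" and "\<And>\<xi>. (K *v \<xi>) \<bullet> \<xi> \<ge> c * (norm \<xi>)\<^sup>2"
  shows "transpose (matrix_inv K) = matrix_inv K"
proof -
  have "\<xi> = 0" if "K *v \<xi> = 0" for \<xi>
  proof -
    have "c * (norm \<xi>)\<^sup>2 \<le> 0" using assms(3)[of \<xi>] that by simp
    then show ?thesis using \<open>c > 0\<close> by (simp add: mult_le_0_iff)
  qed
  then have inv: "invertible K"
    by (simp add: invertible_left_inverse matrix_left_invertible_ker)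
  then have "K ** matrix_inv K = mat 1" "matrix_inv K ** K = mat 1"
    unfolding matrix_inv_def invertible_def by (metis (mono_tags, lifting) someI_ex)+
  then have "transpose (matrix_inv K) ** K = mat 1"
    by (metis assms(1) matrix_transpose_mul transpose_mat)
  then show ?thesis
    by (metis \<open>K ** matrix_inv K = mat 1\<close> matrix_mul_assoc matrix_mul_lid matrix_mul_rid)
qed

section \<open>Essentially bounded functions\<close>

text \<open>This class is closed under sums, powers and bounded bilinear products, and on a finite
  measure space its real-valued members are integrable. As discrete functions belong to it,
  integrability and measurability can be read off from the shape of an integrand.\<close>

definition ess_bounded ::
    "'a measure \<Rightarrow> ('a \<Rightarrow> 'b::{real_normed_vector, second_countable_topology}) \<Rightarrow> bool" where
  "ess_bounded M v \<longleftrightarrow> v \<in> borel_measurable M \<and> (\<exists>C. AE x in M. norm (v x) \<le> C)"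

lemma ess_boundedI:
  "v \<in> borel_measurable M \<Longrightarrow> (AE x in M. norm (v x) \<le> C) \<Longrightarrow> ess_bounded M v"
  by (auto simp: ess_bounded_def)

lemma ess_bounded_measurable: "ess_bounded M v \<Longrightarrow> v \<in> borel_measurable M"
  by (simp add: ess_bounded_def)

lemma ess_boundedE:
  assumes "ess_bounded M v"
  obtains C where "C \<ge> 0" and "AE x in M. norm (v x) \<le> C"
proof -
  from assms obtain C where "AE x in M. norm (v x) \<le> C" by (auto simp: ess_bounded_def)
  then have "AE x in M. norm (v x) \<le> max C 0" by eventually_elim simp
  then show ?thesis using that[of "max C 0"] by simp
qed

lemma ess_bounded_const: "ess_bounded M (\<lambda>x. c)"
  by (rule ess_boundedI[where C = "norm c"]) auto

lemma ess_bounded_norm: "ess_bounded M v \<Longrightarrow> ess_bounded M (\<lambda>x. norm (v x))"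
  by (auto simp: ess_bounded_def)

lemma ess_bounded_add:
  assumes "ess_bounded M v" and "ess_bounded M w"
  shows "ess_bounded M (\<lambda>x. v x + w x)"
proof -
  obtain C D where "AE x in M. norm (v x) \<le> C" "AE x in M. norm (w x) \<le> D"
    using assms by (auto simp: ess_bounded_def)
  then have "AE x in M. norm (v x + w x) \<le> C + D"
    by eventually_elim (rule norm_triangle_mono)
  then show ?thesis
    by (rule ess_boundedI[rotated]) (intro borel_measurable_add ess_bounded_measurable assms)
qed

lemma ess_bounded_bilinear:
  fixes prod :: "'b::{real_normed_vector, second_countable_topology} \<Rightarrow>
    'c::{real_normed_vector, second_countable_topology} \<Rightarrow>
    'd::{real_normed_vector, second_countable_topology}"
  assumes "bounded_bilinear prod" and v: "ess_bounded M v" and w: "ess_bounded M w"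
  shows "ess_bounded M (\<lambda>x. prod (v x) (w x))"
proof -
  interpret bounded_bilinear prod by fact
  obtain k where k: "k \<ge> 0" "\<And>a b. norm (prod a b) \<le> norm a * norm b * k"
    using nonneg_bounded by blast
  obtain C where C: "C \<ge> 0" "AE x in M. norm (v x) \<le> C" using v by (rule ess_boundedE)
  obtain D where D: "D \<ge> 0" "AE x in M. norm (w x) \<le> D" using w by (rule ess_boundedE)
  have "AE x in M. norm (prod (v x) (w x)) \<le> C * D * k"
    using C(2) D(2)
  proof eventually_elim
    case (elim x)
    have "norm (v x) * norm (w x) * k \<le> C * D * k"
      by (intro mult_right_mono mult_mono) (use elim C(1) k(1) in auto)
    then show ?case using k(2)[of "v x" "w x"] by linarith
  qed
  moreover have "(\<lambda>x. prod (v x) (w x)) \<in> borel_measurable M"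
    by (rule borel_measurable_continuous_Pair[OF ess_bounded_measurable[OF v] ess_bounded_measurable[OF w]])
       (intro continuous_on continuous_intros)
  ultimately show ?thesis by (intro ess_boundedI)
qed

lemmas ess_bounded_scaleR = ess_bounded_bilinear[OF bounded_bilinear_scaleR]
lemmas ess_bounded_mult = ess_bounded_bilinear[OF bounded_bilinear_mult]
lemmas ess_bounded_inner = ess_bounded_bilinear[OF bounded_bilinear_inner]

lemma bounded_bilinear_matrix_vector_mult:
  "bounded_bilinear (\<lambda>(A :: real ^ 'n ^ 'm) x. A *v x)"
  unfolding bilinear_conv_bounded_bilinear[symmetric] bilinear_def
  by (auto intro!: linearI simp: matrix_vector_mult_add_rdistrib matrix_vector_right_distrib
      scaleR_matrix_vector_assoc matrix_vector_mult_scaleR)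

lemmas ess_bounded_matrix_vector_mult = ess_bounded_bilinear[OF bounded_bilinear_matrix_vector_mult]

lemma ess_bounded_diff:
  assumes "ess_bounded M v" and "ess_bounded M w"
  shows "ess_bounded M (\<lambda>x. v x - w x)"
  using ess_bounded_add[OF assms(1) ess_bounded_scaleR[OF ess_bounded_const[of M "- 1"] assms(2)]]
  by simp

lemma ess_bounded_power:
  fixes v :: "'a \<Rightarrow> 'b::{real_normed_algebra_1, second_countable_topology}"
  assumes "ess_bounded M v"
  shows "ess_bounded M (\<lambda>x. v x ^ n)"
  by (induction n) (simp_all add: ess_bounded_const ess_bounded_mult[OF assms])

lemma ess_bounded_sum:
  assumes "\<And>j. j \<in> J \<Longrightarrow> ess_bounded M (v j)"
  shows "ess_bounded M (\<lambda>x. \<Sum>j\<in>J. v j x)"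
  using assms by (induction J rule: infinite_finite_induct) (simp_all add: ess_bounded_const ess_bounded_add)

lemmas ess_bounded_intros = ess_bounded_const ess_bounded_norm ess_bounded_add ess_bounded_diff
  ess_bounded_scaleR ess_bounded_mult ess_bounded_inner ess_bounded_matrix_vector_mult
  ess_bounded_power ess_bounded_sum

lemma (in finite_measure) integrable_ess_bounded:
  fixes v :: "'a \<Rightarrow> real"
  assumes "ess_bounded M v"
  shows "integrable M v"
proof -
  obtain C where "C \<ge> 0" "AE x in M. norm (v x) \<le> C" using assms by (rule ess_boundedE)
  then show ?thesis using assms by (intro integrable_const_bound ess_bounded_measurable)
qed

text \<open>The integral of \<open>(s * a x - t * b x)\<^sup>2\<close> is a nonnegative quadratic
  form in \<open>s\<close> and \<open>t\<close>; its discriminant gives the claim.\<close>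

lemma (in finite_measure) L2_Cauchy_Schwarz:
  fixes a b :: "'a \<Rightarrow> real"
  assumes "ess_bounded M a" and "ess_bounded M b"
  shows "(LINT x|M. a x * b x)\<^sup>2 \<le> (LINT x|M. (a x)\<^sup>2) * (LINT x|M. (b x)\<^sup>2)"
proof -
  define A where "A = (LINT x|M. (a x)\<^sup>2)"
  define B where "B = (LINT x|M. (b x)\<^sup>2)"
  define P where "P = (LINT x|M. a x * b x)"
  have [simp]: "integrable M (\<lambda>x. (a x)\<^sup>2)" "integrable M (\<lambda>x. (b x)\<^sup>2)" "integrable M (\<lambda>x. a x * b x)"
    using assms by (intro integrable_ess_bounded ess_bounded_intros; simp)+
  have quad: "0 \<le> s\<^sup>2 * A - 2 * s * t * P + t\<^sup>2 * B" for s t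
  proof -
    have "0 \<le> (LINT x|M. (s * a x - t * b x)\<^sup>2)" by simp
    also have "\<dots> = (LINT x|M. s\<^sup>2 * (a x)\<^sup>2 - 2 * s * t * (a x * b x) + t\<^sup>2 * (b x)\<^sup>2)"
      by (rule Bochner_Integration.integral_cong) (auto simp: power2_eq_square algebra_simps)
    finally show ?thesis by (simp add: A_def B_def P_def)
  qed
  have "A \<ge> 0" "B \<ge> 0" by (auto simp: A_def B_def)
  have "P\<^sup>2 \<le> A * B"
  proof (cases "A = 0")
    case True
    have "P = 0"
    proof (rule ccontr)
      assume "P \<noteq> 0"
      \<comment> \<open>For \<open>A = 0\<close> the form is linear in \<open>s\<close>; at this
        \<open>s\<close> and \<open>t = 1\<close> it would take the value -1.\<close>
      then have "2 * ((B + 1) / (2 * P)) * P = B + 1" by simp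
      then show False using quad[of "(B + 1) / (2 * P)" 1] True by simp
    qed
    then show ?thesis using True by simp
  next
    case False
    have "0 \<le> A * (A * B - P\<^sup>2)"
      \<comment> \<open>At \<open>s = P\<close>, \<open>t = A\<close> the form factors as
        \<open>A * (A * B - P\<^sup>2)\<close>, so nothing has to be divided before the sign is
        known.\<close>
      using quad[of P A] by (simp add: power2_eq_square algebra_simps)
    then show ?thesis using False \<open>A \<ge> 0\<close> by (simp add: zero_le_mult_iff)
  qed
  then show ?thesis by (simp add: A_def B_def P_def)
qed

text \<open>Lebesgue measure is complete, so a change on a null set preserves measurability. This
  matters because the pressure iterates are prescribed only almost everywhere.\<close>

lemma borel_measurable_lebesgue_on_cong_AE:
  fixes v w :: "'a::euclidean_space \<Rightarrow> 'b::{real_normed_vector, second_countable_topology}"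
  assumes "v \<in> borel_measurable (lebesgue_on S)" and "AE x in lebesgue_on S. v x = w x"
    and S: "S \<in> sets lebesgue"
  shows "w \<in> borel_measurable (lebesgue_on S)"
proof -
  interpret complete_measure "lebesgue_on S"
  proof
    fix A B assume "B \<subseteq> A" "A \<in> null_sets (lebesgue_on S)"
    then show "B \<in> sets (lebesgue_on S)"
      using S by (auto simp: null_sets_restrict_space sets_restrict_space_iff
          intro: completion.complete)
  qed
  show ?thesis
  proof (rule borel_measurableI)
    fix U :: "'b set" assume "open U"
    have "AE x in lebesgue_on S. x \<in> v -` U \<inter> space (lebesgue_on S) \<longleftrightarrow> x \<in> w -` U \<inter> space (lebesgue_on S)"
      using assms(2) by eventually_elim simp
    then show "w -` U \<inter> space (lebesgue_on S) \<in> sets (lebesgue_on S)"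
      by (rule in_sets_AE) (use measurable_sets[OF assms(1)] \<open>open U\<close> in auto)
  qed
qed

section \<open>The Darcy--Forchheimer energy\<close>

locale bounded_open_domain =
  fixes \<Omega> :: "(real ^ 'd) set"
  assumes bounded_domain: "bounded \<Omega>" and open_domain: "open \<Omega>"
begin

abbreviation "M \<equiv> lebesgue_on \<Omega>"

lemma domain_lmeasurable: "\<Omega> \<in> lmeasurable"
  using bounded_domain open_domain by (rule lmeasurable_open)

lemma domain_sets_lebesgue: "\<Omega> \<in> sets lebesgue"
  using domain_lmeasurable by blast

sublocale finite_measure M
  by (rule finite_measure_lebesgue_on) (rule domain_lmeasurable)

end

text \<open>The derivative of the energy at \<open>v\<close> in direction \<open>w\<close> without
  its load term, equally the left side of the momentum equation without the pressure. Only
  \<open>w\<close> enters linearly in general.\<close>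

definition DF_form ::
    "(real ^ 'd) set \<Rightarrow> real \<Rightarrow> real \<Rightarrow> real \<Rightarrow> (real ^ 'd \<Rightarrow> real ^ 'd ^ 'd) \<Rightarrow>
     (real ^ 'd \<Rightarrow> real ^ 'd) \<Rightarrow> (real ^ 'd \<Rightarrow> real ^ 'd) \<Rightarrow> real" where
  "DF_form \<Omega> \<mu> \<rho> \<beta> K v w =
     \<mu> / \<rho> * (LINT x|lebesgue_on \<Omega>. (matrix_inv (K x) *v v x) \<bullet> w x)
     + \<beta> / \<rho> * (LINT x|lebesgue_on \<Omega>. (norm (v x) *\<^sub>R v x) \<bullet> w x)"

locale DF_data = bounded_open_domain \<Omega> for \<Omega> :: "(real ^ 'd) set" +
  fixes \<mu> \<rho> \<beta> :: real and K :: "real ^ 'd \<Rightarrow> real ^ 'd ^ 'd"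
  assumes \<mu>_pos: "\<mu> > 0" and \<rho>_pos: "\<rho> > 0" and \<beta>_nonneg: "\<beta> \<ge> 0"
    and permeability: "permeability_tensor \<Omega> K"
begin

lemma ess_bounded_matrix_inv: "ess_bounded M (\<lambda>x. matrix_inv (K x))"
  using permeability by (auto simp: permeability_tensor_def Linfty_matrix_def ess_bounded_def)

lemma matrix_inv_symmetric:
  "AE x in M. \<forall>\<xi> \<eta>. (matrix_inv (K x) *v \<xi>) \<bullet> \<eta> = (matrix_inv (K x) *v \<eta>) \<bullet> \<xi>"
proof -
  obtain c where "c > 0" and pos: "AE x in M. \<forall>\<xi>. (K x *v \<xi>) \<bullet> \<xi> \<ge> c * (norm \<xi>)\<^sup>2"
    using permeability by (auto simp: permeability_tensor_def uniformly_pos_def_def)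
  have "AE x in M. transpose (K x) = K x"
    using permeability by (simp add: permeability_tensor_def)
  with pos have "AE x in M. transpose (matrix_inv (K x)) = matrix_inv (K x)"
  proof eventually_elim
    case (elim x)
    with \<open>c > 0\<close> show ?case by (intro transpose_matrix_inv_symmetric[of _ c]) auto
  qed
  then show ?thesis
  proof eventually_elim
    case (elim x)
    have "(matrix_inv (K x) *v \<xi>) \<bullet> \<eta> = \<xi> \<bullet> (transpose (matrix_inv (K x)) *v \<eta>)" for \<xi> \<eta>
      by (simp only: vector_transpose_matrix[symmetric] dot_lmul_matrix)
    then show ?case by (metis elim inner_commute)
  qed
qed

section \<open>Gateaux derivative of the energy\<close>

text \<open>A remainder of order \<open>t\<^sup>2\<close>, uniform for
  \<open>\<bar>t\<bar> \<le> 1\<close>, replaces differentiation under the integral. The Darcy part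
  is exactly quadratic, the load is linear, and the cubic part inherits the pointwise bound of
  \<open>norm_cube_expansion\<close>.\<close>

lemma DF_energy_expansion:
  assumes v: "ess_bounded M v" and w: "ess_bounded M w"
    and [simp]: "integrable M (\<lambda>x. f x \<bullet> v x)" "integrable M (\<lambda>x. f x \<bullet> w x)"
  shows "\<exists>C. \<forall>t. \<bar>t\<bar> \<le> 1 \<longrightarrow>
    \<bar>DF_energy \<Omega> \<mu> \<rho> \<beta> K f (\<lambda>x. v x + t *\<^sub>R w x) - DF_energy \<Omega> \<mu> \<rho> \<beta> K f v
      - t * (DF_form \<Omega> \<mu> \<rho> \<beta> K v w - (LINT x|M. f x \<bullet> w x))\<bar> \<le> C * t\<^sup>2"
proof -
  define A where "A x = matrix_inv (K x)" for x
  have A: "ess_bounded M A" using ess_bounded_matrix_inv by (simp add: A_def[abs_def])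
  have sym: "AE x in M. \<forall>\<xi> \<eta>. (A x *v \<xi>) \<bullet> \<eta> = (A x *v \<eta>) \<bullet> \<xi>"
    using matrix_inv_symmetric by (simp add: A_def)
  note eb = ess_bounded_intros A v w
  define Q where "Q = (LINT x|M. (A x *v w x) \<bullet> w x)"
  define R where "R = (LINT x|M. (norm (w x))\<^sup>2 * (3 * norm (v x) + norm (w x)))"
  have quad: "(LINT x|M. (A x *v (v x + t *\<^sub>R w x)) \<bullet> (v x + t *\<^sub>R w x))
      = (LINT x|M. (A x *v v x) \<bullet> v x) + 2 * t * (LINT x|M. (A x *v v x) \<bullet> w x) + t\<^sup>2 * Q" for t
  proof -
    have [simp]: "integrable M (\<lambda>x. (A x *v v x) \<bullet> v x)" "integrable M (\<lambda>x. (A x *v v x) \<bullet> w x)"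
      "integrable M (\<lambda>x. (A x *v w x) \<bullet> w x)"
      by (intro integrable_ess_bounded eb)+
    have "(LINT x|M. (A x *v (v x + t *\<^sub>R w x)) \<bullet> (v x + t *\<^sub>R w x))
        = (LINT x|M. (A x *v v x) \<bullet> v x + 2 * t * ((A x *v v x) \<bullet> w x) + t\<^sup>2 * ((A x *v w x) \<bullet> w x))"
    proof (rule integral_cong_AE)
      show "AE x in M. (A x *v (v x + t *\<^sub>R w x)) \<bullet> (v x + t *\<^sub>R w x)
        = (A x *v v x) \<bullet> v x + 2 * t * ((A x *v v x) \<bullet> w x) + t\<^sup>2 * ((A x *v w x) \<bullet> w x)"
        using sym
      proof eventually_elim
        case (elim x)
        \<comment> \<open>Symmetry of the inverse permeability merges the two mixed terms; this is
          what gives the Darcy term of \<open>DF_form\<close> as the derivative.\<close>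
        then have "(A x *v w x) \<bullet> v x = (A x *v v x) \<bullet> w x" by blast
        then show ?case
          by (simp add: matrix_vector_right_distrib matrix_vector_mult_scaleR inner_add_left
              inner_add_right power2_eq_square algebra_simps)
      qed
    qed (intro ess_bounded_measurable eb)+
    then show ?thesis by (simp add: Q_def)
  qed
  have cube: "\<bar>(LINT x|M. norm (v x + t *\<^sub>R w x) ^ 3) - (LINT x|M. norm (v x) ^ 3)
      - 3 * t * (LINT x|M. (norm (v x) *\<^sub>R v x) \<bullet> w x)\<bar> \<le> t\<^sup>2 * R" if "\<bar>t\<bar> \<le> 1" for t
  proof -
    have [simp]: "integrable M (\<lambda>x. norm (v x + t *\<^sub>R w x) ^ 3)" "integrable M (\<lambda>x. norm (v x) ^ 3)"
      "integrable M (\<lambda>x. (norm (v x) *\<^sub>R v x) \<bullet> w x)"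
      "integrable M (\<lambda>x. (norm (w x))\<^sup>2 * (3 * norm (v x) + norm (w x)))"
      by (intro integrable_ess_bounded eb)+
    have "\<bar>LINT x|M. norm (v x + t *\<^sub>R w x) ^ 3 - norm (v x) ^ 3 - 3 * t * ((norm (v x) *\<^sub>R v x) \<bullet> w x)\<bar>
        \<le> (LINT x|M. t\<^sup>2 * ((norm (w x))\<^sup>2 * (3 * norm (v x) + norm (w x))))"
    proof (rule integral_abs_bound_integral)
      fix x
      \<comment> \<open>Restricting to \<open>\<bar>t\<bar> \<le> 1\<close> removes \<open>t\<close>
        from the last factor, so that the integrated remainder \<open>R\<close> is a
        constant.\<close>
      have "\<bar>t\<bar> * norm (w x) \<le> 1 * norm (w x)" using that by (intro mult_right_mono) auto
      then have "t\<^sup>2 * ((norm (w x))\<^sup>2 * (3 * norm (v x) + \<bar>t\<bar> * norm (w x)))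
          \<le> t\<^sup>2 * ((norm (w x))\<^sup>2 * (3 * norm (v x) + norm (w x)))"
        by (intro mult_left_mono) auto
      then show "\<bar>norm (v x + t *\<^sub>R w x) ^ 3 - norm (v x) ^ 3 - 3 * t * ((norm (v x) *\<^sub>R v x) \<bullet> w x)\<bar>
          \<le> t\<^sup>2 * ((norm (w x))\<^sup>2 * (3 * norm (v x) + norm (w x)))"
        using norm_cube_expansion[of "v x" t "w x"] by simp
    qed (intro integrable_ess_bounded eb)+
    then show ?thesis by (simp add: R_def del: inner_scaleR_left)
  qed
  have lin: "(LINT x|M. f x \<bullet> (v x + t *\<^sub>R w x)) = (LINT x|M. f x \<bullet> v x) + t * (LINT x|M. f x \<bullet> w x)" for t
    by (simp add: inner_add_right)
  have "\<bar>DF_energy \<Omega> \<mu> \<rho> \<beta> K f (\<lambda>x. v x + t *\<^sub>R w x) - DF_energy \<Omega> \<mu> \<rho> \<beta> K f v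
      - t * (DF_form \<Omega> \<mu> \<rho> \<beta> K v w - (LINT x|M. f x \<bullet> w x))\<bar>
      \<le> (\<mu> / (2 * \<rho>) * \<bar>Q\<bar> + \<beta> / (3 * \<rho>) * R) * t\<^sup>2" if "\<bar>t\<bar> \<le> 1" for t
  proof -
    define E where "E = (LINT x|M. norm (v x + t *\<^sub>R w x) ^ 3) - (LINT x|M. norm (v x) ^ 3)
      - 3 * t * (LINT x|M. (norm (v x) *\<^sub>R v x) \<bullet> w x)"
    have "\<bar>E\<bar> \<le> t\<^sup>2 * R" using cube[OF that] by (simp add: E_def)
    then have "\<bar>\<beta> / (3 * \<rho>) * E\<bar> \<le> \<beta> / (3 * \<rho>) * (t\<^sup>2 * R)"
      using \<beta>_nonneg \<rho>_pos unfolding abs_mult by (intro mult_mono) auto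
    moreover have "\<bar>\<mu> / (2 * \<rho>) * (t\<^sup>2 * Q)\<bar> = \<mu> / (2 * \<rho>) * (t\<^sup>2 * \<bar>Q\<bar>)"
      using \<mu>_pos \<rho>_pos by (simp add: abs_mult)
    moreover have "DF_energy \<Omega> \<mu> \<rho> \<beta> K f (\<lambda>x. v x + t *\<^sub>R w x) - DF_energy \<Omega> \<mu> \<rho> \<beta> K f v
        - t * (DF_form \<Omega> \<mu> \<rho> \<beta> K v w - (LINT x|M. f x \<bullet> w x))
        = \<mu> / (2 * \<rho>) * (t\<^sup>2 * Q) + \<beta> / (3 * \<rho>) * E"
    proof -
      have cube_eq: "(LINT x|M. norm (v x + t *\<^sub>R w x) ^ 3) = (LINT x|M. norm (v x) ^ 3)
          + 3 * t * (LINT x|M. (norm (v x) *\<^sub>R v x) \<bullet> w x) + E"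
        by (simp add: E_def)
      show ?thesis
        unfolding DF_energy_def DF_form_def A_def[symmetric] quad lin cube_eq
        using \<rho>_pos by (simp add: field_simps del: inner_scaleR_left)
    qed
    moreover have "(\<mu> / (2 * \<rho>) * \<bar>Q\<bar> + \<beta> / (3 * \<rho>) * R) * t\<^sup>2
        = \<mu> / (2 * \<rho>) * (t\<^sup>2 * \<bar>Q\<bar>) + \<beta> / (3 * \<rho>) * (t\<^sup>2 * R)"
      by (simp add: algebra_simps)
    ultimately show ?thesis by linarith
  qed
  then show ?thesis by blast
qed

lemma DF_energy_has_derivative:
  assumes "ess_bounded M v" and "ess_bounded M w"
    and "integrable M (\<lambda>x. f x \<bullet> v x)" and "integrable M (\<lambda>x. f x \<bullet> w x)"
  shows "((\<lambda>t. DF_energy \<Omega> \<mu> \<rho> \<beta> K f (\<lambda>x. v x + t *\<^sub>R w x)) has_real_derivative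
    DF_form \<Omega> \<mu> \<rho> \<beta> K v w - (LINT x|M. f x \<bullet> w x)) (at 0)"
proof -
  define h where "h t = DF_energy \<Omega> \<mu> \<rho> \<beta> K f (\<lambda>x. v x + t *\<^sub>R w x)" for t
  define L where "L = DF_form \<Omega> \<mu> \<rho> \<beta> K v w - (LINT x|M. f x \<bullet> w x)"
  from DF_energy_expansion[OF assms] obtain C where
    C: "\<And>t. \<bar>t\<bar> \<le> 1 \<Longrightarrow> \<bar>h t - h 0 - t * L\<bar> \<le> C * t\<^sup>2"
    unfolding h_def L_def by auto
  have "((\<lambda>t. (h t - h 0) / t - L) \<longlongrightarrow> 0) (at 0)"
  proof (rule Lim_null_comparison)
    show "((\<lambda>t. C * \<bar>t\<bar>) \<longlongrightarrow> 0) (at 0)"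
      by (auto intro!: tendsto_eq_intros)
    have "\<forall>\<^sub>F t in at 0. \<bar>t\<bar> \<le> (1::real) \<and> t \<noteq> 0"
      by (auto simp: eventually_at dist_norm intro!: exI[of _ 1])
    then show "\<forall>\<^sub>F t in at 0. norm ((h t - h 0) / t - L) \<le> C * \<bar>t\<bar>"
    proof eventually_elim
      case (elim t)
      have "\<bar>(h t - h 0) / t - L\<bar> = \<bar>h t - h 0 - t * L\<bar> / \<bar>t\<bar>"
        using elim by (simp add: diff_divide_distrib abs_divide[symmetric])
      also have "\<dots> \<le> C * t\<^sup>2 / \<bar>t\<bar>"
        using C[of t] elim by (intro divide_right_mono) auto
      also have "\<dots> = C * \<bar>t\<bar>"
        using elim by (simp add: field_simps power2_eq_square abs_mult_self_eq)
      finally show ?case by simp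
    qed
  qed
  then have "((\<lambda>t. (h t - h 0) / (t - 0)) \<longlongrightarrow> L) (at 0)"
    using Lim_null by fastforce
  then show ?thesis
    unfolding h_def[symmetric] L_def[symmetric] by (simp add: has_field_derivative_iff)
qed

section \<open>Strong monotonicity and local continuity of the derivative\<close>

lemma DF_form_diff:
  assumes "ess_bounded M u" and "ess_bounded M v" and "ess_bounded M w"
  shows "DF_form \<Omega> \<mu> \<rho> \<beta> K u w - DF_form \<Omega> \<mu> \<rho> \<beta> K v w
    = (LINT x|M. \<mu> / \<rho> * ((matrix_inv (K x) *v (u x - v x)) \<bullet> w x)
        + \<beta> / \<rho> * ((norm (u x) *\<^sub>R u x - norm (v x) *\<^sub>R v x) \<bullet> w x))"
proof -
  note eb = ess_bounded_intros ess_bounded_matrix_inv assms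
  have [simp]: "integrable M (\<lambda>x. (matrix_inv (K x) *v u x) \<bullet> w x)" "integrable M (\<lambda>x. (norm (u x) *\<^sub>R u x) \<bullet> w x)"
    "integrable M (\<lambda>x. (matrix_inv (K x) *v v x) \<bullet> w x)" "integrable M (\<lambda>x. (norm (v x) *\<^sub>R v x) \<bullet> w x)"
    by (intro integrable_ess_bounded eb)+
  show ?thesis
    by (simp add: DF_form_def matrix_vector_mult_diff_distrib inner_diff_left right_diff_distrib
        del: inner_scaleR_left)
qed

text \<open>The Darcy term alone supplies the constant, through uniform positivity of the inverse
  permeability; the Forchheimer term contributes something nonnegative. Hence \<open>c\<close>
  depends on neither argument.\<close>

lemma DF_form_coercive:
  obtains c where "c > 0"
    and "\<And>u v. ess_bounded M u \<Longrightarrow> ess_bounded M v \<Longrightarrow>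
      c * (LINT x|M. (norm (u x - v x))\<^sup>2)
      \<le> DF_form \<Omega> \<mu> \<rho> \<beta> K u (\<lambda>x. u x - v x) - DF_form \<Omega> \<mu> \<rho> \<beta> K v (\<lambda>x. u x - v x)"
proof -
  obtain c where "c > 0" and c: "AE x in M. \<forall>\<xi>. (matrix_inv (K x) *v \<xi>) \<bullet> \<xi> \<ge> c * (norm \<xi>)\<^sup>2"
    using permeability by (auto simp: permeability_tensor_def uniformly_pos_def_def)
  show thesis
  proof (rule that[of "\<mu> / \<rho> * c"])
    show "\<mu> / \<rho> * c > 0" using \<mu>_pos \<rho>_pos \<open>c > 0\<close> by simp
    fix u v :: "real ^ 'd \<Rightarrow> real ^ 'd" assume uv: "ess_bounded M u" "ess_bounded M v"
    note eb = ess_bounded_intros ess_bounded_matrix_inv uv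
    have "(LINT x|M. \<mu> / \<rho> * c * (norm (u x - v x))\<^sup>2)
        \<le> (LINT x|M. \<mu> / \<rho> * ((matrix_inv (K x) *v (u x - v x)) \<bullet> (u x - v x))
        + \<beta> / \<rho> * ((norm (u x) *\<^sub>R u x - norm (v x) *\<^sub>R v x) \<bullet> (u x - v x)))"
    proof (rule integral_mono_AE)
      show "AE x in M. \<mu> / \<rho> * c * (norm (u x - v x))\<^sup>2
          \<le> \<mu> / \<rho> * ((matrix_inv (K x) *v (u x - v x)) \<bullet> (u x - v x))
          + \<beta> / \<rho> * ((norm (u x) *\<^sub>R u x - norm (v x) *\<^sub>R v x) \<bullet> (u x - v x))"
        using c
      proof eventually_elim
        case (elim x)
        have "\<mu> / \<rho> * (c * (norm (u x - v x))\<^sup>2) \<le> \<mu> / \<rho> * ((matrix_inv (K x) *v (u x - v x)) \<bullet> (u x - v x))"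
          using elim \<mu>_pos \<rho>_pos by (intro mult_left_mono) auto
        moreover have "0 \<le> \<beta> / \<rho> * ((norm (u x) *\<^sub>R u x - norm (v x) *\<^sub>R v x) \<bullet> (u x - v x))"
          using \<beta>_nonneg \<rho>_pos by (intro mult_nonneg_nonneg norm_scale_monotone) auto
        ultimately show ?case by (simp only: mult.assoc)
      qed
    qed (intro integrable_ess_bounded eb)+
    then show "\<mu> / \<rho> * c * (LINT x|M. (norm (u x - v x))\<^sup>2)
        \<le> DF_form \<Omega> \<mu> \<rho> \<beta> K u (\<lambda>x. u x - v x) - DF_form \<Omega> \<mu> \<rho> \<beta> K v (\<lambda>x. u x - v x)"
      unfolding DF_form_diff[OF uv ess_bounded_diff[OF uv]] by simp
  qed
qed

text \<open>With \<open>v\<close> and \<open>w\<close> fixed and bounded, the Darcy difference is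
  linear in \<open>u - v\<close> and the Forchheimer difference at most linear plus quadratic. Thus
  \<open>B\<close> does not depend on \<open>u\<close>, for which only measurability and essential
  boundedness, not the size of the bound, matter.\<close>

lemma DF_form_continuous:
  assumes v: "ess_bounded M v" and w: "ess_bounded M w"
  obtains B where "B \<ge> 0"
    and "\<And>u. ess_bounded M u \<Longrightarrow>
      \<bar>DF_form \<Omega> \<mu> \<rho> \<beta> K u w - DF_form \<Omega> \<mu> \<rho> \<beta> K v w\<bar>
      \<le> B * (sqrt (LINT x|M. (norm (u x - v x))\<^sup>2) + (LINT x|M. (norm (u x - v x))\<^sup>2))"
proof -
  define A where "A x = matrix_inv (K x)" for x
  have A: "ess_bounded M A" using ess_bounded_matrix_inv by (simp add: A_def[abs_def])
  obtain k where k: "k > 0" "\<And>(a::real^'d^'d) b. norm (a *v b) \<le> norm a * norm b * k"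
    using bounded_bilinear.pos_bounded[OF bounded_bilinear_matrix_vector_mult] by blast
  obtain CA where CA: "CA \<ge> 0" "AE x in M. norm (A x) \<le> CA" using A by (rule ess_boundedE)
  obtain Cv where Cv: "Cv \<ge> 0" "AE x in M. norm (v x) \<le> Cv" using v by (rule ess_boundedE)
  obtain Cw where Cw: "Cw \<ge> 0" "AE x in M. norm (w x) \<le> Cw" using w by (rule ess_boundedE)
  \<comment> \<open>\<open>B1\<close> and \<open>B2\<close> are the pointwise coefficients of
    \<open>norm (u x - v x)\<close> and of its square; \<open>m\<close> will convert the L1 norm
    into the L2 norm.\<close>
  define B1 where "B1 = (\<mu> / \<rho> * (CA * k) + \<beta> / \<rho> * (2 * Cv)) * Cw"
  define B2 where "B2 = \<beta> / \<rho> * Cw"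
  define m where "m = sqrt (measure M (space M))"
  have nonneg: "B1 \<ge> 0" "B2 \<ge> 0" "m \<ge> 0"
    using CA Cv Cw k \<mu>_pos \<rho>_pos \<beta>_nonneg by (auto simp: B1_def B2_def m_def)
  show thesis
  proof (rule that[of "B1 * m + B2"])
    show "B1 * m + B2 \<ge> 0" using nonneg by simp
    fix u :: "real ^ 'd \<Rightarrow> real ^ 'd" assume u: "ess_bounded M u"
    note eb = ess_bounded_intros A v w u
    define W where "W = (LINT x|M. (norm (u x - v x))\<^sup>2)"
    have "W \<ge> 0" by (simp add: W_def)
    have [simp]: "integrable M (\<lambda>x. norm (u x - v x))" "integrable M (\<lambda>x. (norm (u x - v x))\<^sup>2)"
      by (intro integrable_ess_bounded eb)+
    \<comment> \<open>Cauchy--Schwarz against the constant 1 bounds the L1 norm by the L2 norm on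
      the bounded domain.\<close>
    have "(LINT x|M. norm (u x - v x) * 1)\<^sup>2 \<le> W * (LINT x|M. 1\<^sup>2)"
      unfolding W_def by (intro L2_Cauchy_Schwarz eb)
    then have "(LINT x|M. norm (u x - v x))\<^sup>2 \<le> W * m\<^sup>2"
      by (simp add: m_def)
    then have CS: "(LINT x|M. norm (u x - v x)) \<le> sqrt W * m"
      using nonneg real_le_rsqrt[of "LINT x|M. norm (u x - v x)" "W * m\<^sup>2"] by (simp add: real_sqrt_mult)
    have "\<bar>DF_form \<Omega> \<mu> \<rho> \<beta> K u w - DF_form \<Omega> \<mu> \<rho> \<beta> K v w\<bar>
        \<le> (LINT x|M. B1 * norm (u x - v x) + B2 * (norm (u x - v x))\<^sup>2)"
      unfolding DF_form_diff[OF u v w] A_def[symmetric]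
    proof (rule order_trans[OF integral_abs_bound], rule integral_mono_AE)
      show "AE x in M. \<bar>\<mu> / \<rho> * ((A x *v (u x - v x)) \<bullet> w x) + \<beta> / \<rho> * ((norm (u x) *\<^sub>R u x - norm (v x) *\<^sub>R v x) \<bullet> w x)\<bar>
          \<le> B1 * norm (u x - v x) + B2 * (norm (u x - v x))\<^sup>2"
        using CA(2) Cv(2) Cw(2)
      proof eventually_elim
        case (elim x)
        define d where "d = norm (u x - v x)"
        have "d \<ge> 0" by (simp add: d_def)
        have "norm (A x *v (u x - v x)) \<le> norm (A x) * d * k" using k(2) by (simp add: d_def)
        also have "\<dots> \<le> CA * d * k" using elim k \<open>d \<ge> 0\<close> by (intro mult_right_mono) auto
        finally have 1: "norm (A x *v (u x - v x)) \<le> CA * d * k" .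
        have "\<bar>(A x *v (u x - v x)) \<bullet> w x\<bar> \<le> norm (A x *v (u x - v x)) * norm (w x)"
          by (rule Cauchy_Schwarz_ineq2)
        also have "\<dots> \<le> CA * d * k * Cw"
          using 1 elim CA k \<open>d \<ge> 0\<close> by (intro mult_mono) auto
        finally have a: "\<bar>(A x *v (u x - v x)) \<bullet> w x\<bar> \<le> CA * d * k * Cw" .
        have "2 * norm (v x) * d \<le> 2 * Cv * d"
          using elim \<open>d \<ge> 0\<close> by (intro mult_right_mono) auto
        then have 2: "norm (norm (u x) *\<^sub>R u x - norm (v x) *\<^sub>R v x) \<le> 2 * Cv * d + d\<^sup>2"
          using norm_scale_lipschitz[of "u x" "v x"] by (simp add: d_def)
        have "\<bar>(norm (u x) *\<^sub>R u x - norm (v x) *\<^sub>R v x) \<bullet> w x\<bar>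
            \<le> norm (norm (u x) *\<^sub>R u x - norm (v x) *\<^sub>R v x) * norm (w x)"
          by (rule Cauchy_Schwarz_ineq2)
        also have "\<dots> \<le> (2 * Cv * d + d\<^sup>2) * Cw"
          using 2 elim Cv \<open>d \<ge> 0\<close> by (intro mult_mono) auto
        finally have b: "\<bar>(norm (u x) *\<^sub>R u x - norm (v x) *\<^sub>R v x) \<bullet> w x\<bar> \<le> (2 * Cv * d + d\<^sup>2) * Cw" .
        have "\<bar>\<mu> / \<rho> * ((A x *v (u x - v x)) \<bullet> w x)\<bar> \<le> \<mu> / \<rho> * (CA * d * k * Cw)"
          using a \<mu>_pos \<rho>_pos unfolding abs_mult by (intro mult_mono) auto
        moreover have "\<bar>\<beta> / \<rho> * ((norm (u x) *\<^sub>R u x - norm (v x) *\<^sub>R v x) \<bullet> w x)\<bar>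
            \<le> \<beta> / \<rho> * ((2 * Cv * d + d\<^sup>2) * Cw)"
          using b \<beta>_nonneg \<rho>_pos unfolding abs_mult by (intro mult_mono) auto
        moreover have "B1 * d + B2 * d\<^sup>2 = \<mu> / \<rho> * (CA * d * k * Cw) + \<beta> / \<rho> * ((2 * Cv * d + d\<^sup>2) * Cw)"
          by (simp add: B1_def B2_def algebra_simps add_divide_distrib)
        ultimately show ?case unfolding d_def[symmetric] by linarith
      qed
    qed (intro integrable_abs integrable_ess_bounded eb)+
    also have "\<dots> = B1 * (LINT x|M. norm (u x - v x)) + B2 * W"
      by (simp add: W_def)
    also have "\<dots> \<le> B1 * (sqrt W * m) + B2 * W"
      using CS nonneg by (intro add_right_mono mult_left_mono)
    also have "\<dots> \<le> (B1 * m + B2) * (sqrt W + W)"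
      using nonneg \<open>W \<ge> 0\<close> by (simp add: algebra_simps)
    finally show "\<bar>DF_form \<Omega> \<mu> \<rho> \<beta> K u w - DF_form \<Omega> \<mu> \<rho> \<beta> K v w\<bar> \<le> (B1 * m + B2) *
        (sqrt (LINT x|M. (norm (u x - v x))\<^sup>2) + (LINT x|M. (norm (u x - v x))\<^sup>2))"
      by (simp add: W_def)
  qed
qed

end

section \<open>Raviart--Thomas-type pairs\<close>

lemma fn_span_add_scaleR:
  assumes "v \<in> fn_span B" and "w \<in> fn_span B"
  shows "(\<lambda>x. v x + t *\<^sub>R w x) \<in> fn_span B"
proof -
  obtain c d where "v = (\<lambda>x. \<Sum>b\<in>B. c b *\<^sub>R b x)" "w = (\<lambda>x. \<Sum>b\<in>B. d b *\<^sub>R b x)"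
    using assms by (auto simp: fn_span_def)
  then have "(\<lambda>x. v x + t *\<^sub>R w x) = (\<lambda>x. \<Sum>b\<in>B. (c b + t * d b) *\<^sub>R b x)"
    by (simp add: scaleR_sum_right sum.distrib scaleR_add_left)
  then show ?thesis by (auto simp: fn_span_def)
qed

lemma fn_span_zero: "(\<lambda>x. 0) \<in> fn_span B"
  by (auto simp: fn_span_def intro!: exI[of _ "\<lambda>b. 0"])

lemma fn_span_base:
  assumes "finite B" and "b \<in> B"
  shows "b \<in> fn_span B"
proof -
  have "b = (\<lambda>x. \<Sum>b'\<in>B. (if b' = b then 1 else 0) *\<^sub>R b' x)"
  proof
    fix x
    have "(\<Sum>b'\<in>B. (if b' = b then 1 else 0) *\<^sub>R b' x) = (\<Sum>b'\<in>B. if b' = b then b x else 0)"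
      by (rule sum.cong) auto
    then show "b x = (\<Sum>b'\<in>B. (if b' = b then 1 else 0) *\<^sub>R b' x)"
      using assms by simp
  qed
  then show ?thesis
    unfolding fn_span_def mem_Collect_eq by (rule exI[of _ "\<lambda>b'. if b' = b then 1 else 0"])
qed

lemma local_polynomial_space_add_scaleR:
  "local_polynomial_space S \<Longrightarrow> v \<in> S \<Longrightarrow> w \<in> S \<Longrightarrow> (\<lambda>x. v x + t *\<^sub>R w x) \<in> S"
  unfolding local_polynomial_space_def using fn_span_add_scaleR by blast

context bounded_open_domain
begin

lemma ess_bounded_L2_space: "ess_bounded M q \<Longrightarrow> q \<in> L2_space \<Omega>"
  unfolding L2_space_def
  by (auto intro: ess_bounded_measurable integrable_ess_bounded ess_bounded_power)

lemma ess_bounded_L3_space: "ess_bounded M v \<Longrightarrow> v \<in> L3_space \<Omega>"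
  unfolding L3_space_def
  by (auto intro!: ess_bounded_measurable integrable_ess_bounded ess_bounded_power[OF ess_bounded_norm])

lemma ess_bounded_continuous:
  fixes h :: "real ^ 'd \<Rightarrow> 'b::euclidean_space"
  assumes "continuous_on UNIV h"
  shows "ess_bounded M h"
proof -
  have "compact (h ` closure \<Omega>)"
    using bounded_domain assms by (intro compact_continuous_image) (auto intro: continuous_on_subset)
  then obtain C where "\<And>x. x \<in> closure \<Omega> \<Longrightarrow> norm (h x) \<le> C"
    using compact_imp_bounded by (metis bounded_iff imageI)
  then have "AE x in M. norm (h x) \<le> C"
    using closure_subset by (intro AE_I2) auto
  moreover have "h \<in> borel_measurable M"
    using assms domain_sets_lebesgue
    by (intro continuous_imp_measurable_on_sets_lebesgue) (auto intro: continuous_on_subset)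
  ultimately show ?thesis by (intro ess_boundedI)
qed

lemma test_function_ess_bounded:
  assumes "test_function S \<phi>"
  shows "ess_bounded M \<phi>" and "ess_bounded M (grad \<phi>)"
proof -
  have Ck: "Ck k \<phi>" for k using assms by (simp add: test_function_def)
  show "ess_bounded M \<phi>" using Ck[of 0] by (intro ess_bounded_continuous) simp
  have "continuous_on UNIV (\<lambda>x. \<chi> i. grad \<phi> x $ i)"
    using Ck[of "Suc 0"] by (intro continuous_on_vec_lambda) simp
  then show "ess_bounded M (grad \<phi>)" by (intro ess_bounded_continuous) simp
qed

lemma is_weak_div_add_scaleR:
  assumes eb: "ess_bounded M v" "ess_bounded M w" "ess_bounded M a" "ess_bounded M b"
    and "is_weak_div \<Omega> v a" and "is_weak_div \<Omega> w b"
  shows "is_weak_div \<Omega> (\<lambda>x. v x + t *\<^sub>R w x) (\<lambda>x. a x + t * b x)"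
  unfolding is_weak_div_def
proof (intro allI impI)
  fix \<phi> assume \<phi>: "test_function \<Omega> \<phi>"
  note eb = eb test_function_ess_bounded[OF \<phi>]
  have [simp]: "integrable M (\<lambda>x. v x \<bullet> grad \<phi> x)" "integrable M (\<lambda>x. w x \<bullet> grad \<phi> x)"
    "integrable M (\<lambda>x. a x * \<phi> x)" "integrable M (\<lambda>x. b x * \<phi> x)"
    by (intro integrable_ess_bounded ess_bounded_intros eb)+
  have "(LINT x|M. (v x + t *\<^sub>R w x) \<bullet> grad \<phi> x)
      = (LINT x|M. v x \<bullet> grad \<phi> x) + t * (LINT x|M. w x \<bullet> grad \<phi> x)"
    by (simp add: inner_add_left)
  also have "\<dots> = - (LINT x|M. a x * \<phi> x) + t * - (LINT x|M. b x * \<phi> x)"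
    using assms(5,6) \<phi> by (simp add: is_weak_div_def)
  also have "\<dots> = - (LINT x|M. (a x + t * b x) * \<phi> x)"
    by (simp add: distrib_right mult.assoc)
  finally show "(LINT x|M. (v x + t *\<^sub>R w x) \<bullet> grad \<phi> x) = - (LINT x|M. (a x + t * b x) * \<phi> x)" .
qed

end

lemma wdiv_is_weak_div:
  assumes "v \<in> X_space \<Omega>"
  shows "is_weak_div \<Omega> v (wdiv \<Omega> v)"
proof -
  have "\<exists>w. w \<in> L2_space \<Omega> \<and> is_weak_div \<Omega> v w"
    using assms by (auto simp: X_space_def)
  then show ?thesis unfolding wdiv_def by (rule someI2_ex) simp
qed

locale RT_pair = bounded_open_domain \<Omega> for \<Omega> :: "(real ^ 'd) set" +
  fixes \<T> :: "(real ^ 'd) set set" and Xh :: "(real ^ 'd \<Rightarrow> real ^ 'd) set"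
    and Mh :: "(real ^ 'd \<Rightarrow> real) set"
  assumes partition: "partition_of_domain \<Omega> \<T>" and pair: "RT_type_pair \<Omega> \<T> Xh Mh"
begin

lemma partitionD:
  shows "finite \<T>" and "\<Union>\<T> = closure \<Omega>"
    and "T \<in> \<T> \<Longrightarrow> polytope T" and "T \<in> \<T> \<Longrightarrow> interior T \<subseteq> \<Omega>"
    and "S \<in> \<T> \<Longrightarrow> T \<in> \<T> \<Longrightarrow> S \<noteq> T \<Longrightarrow> interior S \<inter> interior T = {}"
  using partition by (auto simp: partition_of_domain_def)

section \<open>Elements up to null sets and boundedness of discrete functions\<close>

text \<open>Polytopes are convex, so their frontiers are negligible. Together with the disjointness
  of the interiors, almost every point belongs to exactly one element.\<close>

lemma AE_element_interior:
  assumes "T \<in> \<T>"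
  shows "AE x in M. x \<in> T \<longrightarrow> x \<in> interior T"
proof -
  have "frontier T \<in> null_sets lebesgue"
    using partitionD(3)[OF assms] polytope_imp_convex negligible_convex_frontier
    by (auto simp: negligible_iff_null_sets)
  then have "AE x in lebesgue. x \<notin> frontier T" by (rule AE_not_in)
  then have "AE x in M. x \<notin> frontier T"
    using domain_sets_lebesgue by (subst AE_restrict_space_iff) auto
  then show ?thesis
    by eventually_elim (auto simp: frontier_def closure_def)
qed

lemma AE_all_element_interior: "AE x in M. \<forall>T\<in>\<T>. x \<in> T \<longrightarrow> x \<in> interior T"
  using AE_element_interior partitionD(1) by (simp add: AE_finite_all)

lemma AE_in_element: "AE x in M. \<exists>T\<in>\<T>. x \<in> interior T"
  using AE_all_element_interior AE_space
proof eventually_elim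
  case (elim x)
  then have "x \<in> \<Union>\<T>" using partitionD(2) closure_subset[of \<Omega>] by auto
  then show ?case using elim by blast
qed

text \<open>Polynomials are bounded on the compact elements, and there are finitely many elements.
  This puts both discrete spaces into the class \<open>ess_bounded\<close>.\<close>

lemma ess_bounded_piecewise_polynomial:
  fixes v :: "real ^ 'd \<Rightarrow> 'b::euclidean_space"
  assumes "v \<in> borel_measurable M"
    and "\<And>T. T \<in> \<T> \<Longrightarrow> \<exists>w. polynomial_function w \<and> (AE x in M. x \<in> T \<longrightarrow> v x = w x)"
  shows "ess_bounded M v"
proof -
  have "\<exists>C\<ge>0. AE x in M. x \<in> T \<longrightarrow> norm (v x) \<le> C" if T: "T \<in> \<T>" for T
  proof -
    obtain w where w: "polynomial_function w" "AE x in M. x \<in> T \<longrightarrow> v x = w x"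
      using assms(2)[OF T] by blast
    have "compact (w ` T)"
      using partitionD(3)[OF T] polytope_imp_compact w(1)
      by (intro compact_continuous_image continuous_on_polymonial_function)
    then obtain C where C: "\<And>x. x \<in> T \<Longrightarrow> norm (w x) \<le> C"
      using compact_imp_bounded by (metis bounded_iff imageI)
    from w(2) have "AE x in M. x \<in> T \<longrightarrow> norm (v x) \<le> max C 0"
      by eventually_elim (use C in force)
    then show ?thesis by (intro exI[of _ "max C 0"]) simp
  qed
  then obtain C where C: "\<And>T. T \<in> \<T> \<Longrightarrow> C T \<ge> (0::real)"
    "\<And>T. T \<in> \<T> \<Longrightarrow> AE x in M. x \<in> T \<longrightarrow> norm (v x) \<le> C T"
    by metis
  have "AE x in M. \<forall>T\<in>\<T>. x \<in> T \<longrightarrow> norm (v x) \<le> C T"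
    using C(2) partitionD(1) by (simp add: AE_finite_all)
  \<comment> \<open>The sum stands in for the maximum of the elementwise bounds, which were chosen
    nonnegative for this purpose.\<close>
  with AE_in_element have "AE x in M. norm (v x) \<le> (\<Sum>T\<in>\<T>. C T)"
  proof eventually_elim
    case (elim x)
    then obtain T where T: "T \<in> \<T>" "norm (v x) \<le> C T" using interior_subset by blast
    then show ?case using member_le_sum[of T \<T> C] C(1) partitionD(1) by force
  qed
  with assms(1) show ?thesis by (rule ess_boundedI)
qed

lemma wdiv_in_Mh: "v \<in> Xh \<Longrightarrow> wdiv \<Omega> v \<in> Mh"
  using pair by (simp add: RT_type_pair_def)

lemma div_onto_Mh:
  assumes "q \<in> Mh"
  obtains v where "v \<in> Xh" and "AE x in M. wdiv \<Omega> v x = q x"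
  using pair assms unfolding RT_type_pair_def by blast

lemma velocity_local_spaces:
  obtains XT where "\<And>T. T \<in> \<T> \<Longrightarrow> local_polynomial_space (XT T)"
    and "Xh = fe_velocity_space \<Omega> \<T> XT"
  using pair unfolding RT_type_pair_def by blast

lemma pressure_local_spaces:
  obtains MT where "\<And>T. T \<in> \<T> \<Longrightarrow> local_polynomial_space (MT T)"
    and "Mh = fe_pressure_space \<Omega> \<T> MT"
  using pair unfolding RT_type_pair_def by blast

lemma Xh_X_space: "v \<in> Xh \<Longrightarrow> v \<in> X_space \<Omega>"
  by (rule velocity_local_spaces) (auto simp: fe_velocity_space_def)

lemma Xh_ess_bounded:
  assumes "v \<in> Xh"
  shows "ess_bounded M v"
proof -
  obtain XT where XT: "\<And>T. T \<in> \<T> \<Longrightarrow> local_polynomial_space (XT T)"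
    and Xh: "Xh = fe_velocity_space \<Omega> \<T> XT" using velocity_local_spaces by blast
  show ?thesis
  proof (rule ess_bounded_piecewise_polynomial)
    show "v \<in> borel_measurable M"
      using assms by (simp add: Xh fe_velocity_space_def X_space_def L3_space_def)
    fix T assume T: "T \<in> \<T>"
    then obtain w where "w \<in> XT T" and w: "AE x in M. x \<in> T \<longrightarrow> v x = w x"
      using assms unfolding Xh fe_velocity_space_def by blast
    then have "polynomial_function w" using XT[OF T] by (auto simp: local_polynomial_space_def)
    with w show "\<exists>w. polynomial_function w \<and> (AE x in M. x \<in> T \<longrightarrow> v x = w x)"
      by (intro exI[of _ w] conjI)
  qed
qed

lemma Mh_ess_bounded:
  assumes "q \<in> Mh"
  shows "ess_bounded M q"
proof -
  obtain MT where MT: "\<And>T. T \<in> \<T> \<Longrightarrow> local_polynomial_space (MT T)"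
    and Mh: "Mh = fe_pressure_space \<Omega> \<T> MT" using pressure_local_spaces by blast
  show ?thesis
  proof (rule ess_bounded_piecewise_polynomial)
    show "q \<in> borel_measurable M"
      using assms by (simp add: Mh fe_pressure_space_def L2_space_def)
    fix T assume T: "T \<in> \<T>"
    then obtain w where "w \<in> MT T" and w: "AE x in M. x \<in> T \<longrightarrow> q x = w x"
      using assms unfolding Mh fe_pressure_space_def by blast
    then have "polynomial_function w" using MT[OF T] by (auto simp: local_polynomial_space_def)
    with w show "\<exists>w. polynomial_function w \<and> (AE x in M. x \<in> T \<longrightarrow> q x = w x)"
      by (intro exI[of _ w] conjI)
  qed
qed

lemma wdiv_ess_bounded: "v \<in> Xh \<Longrightarrow> ess_bounded M (wdiv \<Omega> v)"
  by (intro Mh_ess_bounded wdiv_in_Mh)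

section \<open>Linear structure of the discrete spaces\<close>

lemma Mh_add_scale:
  assumes "q \<in> Mh" and "r \<in> Mh"
  shows "(\<lambda>x. q x + t * r x) \<in> Mh"
proof -
  obtain MT where MT: "\<And>T. T \<in> \<T> \<Longrightarrow> local_polynomial_space (MT T)"
    and Mh: "Mh = fe_pressure_space \<Omega> \<T> MT" using pressure_local_spaces by blast
  have "\<exists>s\<in>MT T. AE x in M. x \<in> T \<longrightarrow> q x + t * r x = s x" if T: "T \<in> \<T>" for T
  proof -
    obtain a b where ab: "a \<in> MT T" "b \<in> MT T"
      and a: "AE x in M. x \<in> T \<longrightarrow> q x = a x" and b: "AE x in M. x \<in> T \<longrightarrow> r x = b x"
      using assms T unfolding Mh fe_pressure_space_def by blast
    from a b have "AE x in M. x \<in> T \<longrightarrow> q x + t * r x = a x + t *\<^sub>R b x"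
      by eventually_elim simp
    then show ?thesis
      by (rule bexI[where x = "\<lambda>x. a x + t *\<^sub>R b x"])
         (rule local_polynomial_space_add_scaleR[OF MT[OF T] ab])
  qed
  moreover have "(\<lambda>x. q x + t * r x) \<in> L2_space \<Omega>"
    using assms by (intro ess_bounded_L2_space ess_bounded_add ess_bounded_mult ess_bounded_const Mh_ess_bounded)
  ultimately show ?thesis by (simp add: Mh fe_pressure_space_def)
qed

lemma Mh_diff: "q \<in> Mh \<Longrightarrow> r \<in> Mh \<Longrightarrow> (\<lambda>x. q x - r x) \<in> Mh"
  using Mh_add_scale[of q r "- 1"] by simp

text \<open>The multiplier update holds only almost everywhere; this invariance keeps the iterates
  in \<open>Mh\<close>.\<close>

lemma Mh_cong_AE:
  assumes "q \<in> Mh" and eq: "AE x in M. r x = q x"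
  shows "r \<in> Mh"
proof -
  obtain MT where MT: "\<And>T. T \<in> \<T> \<Longrightarrow> local_polynomial_space (MT T)"
    and Mh: "Mh = fe_pressure_space \<Omega> \<T> MT" using pressure_local_spaces by blast
  have "q \<in> borel_measurable M" using ess_bounded_measurable[OF Mh_ess_bounded[OF assms(1)]] .
  moreover have "AE x in M. q x = r x" using eq by eventually_elim simp
  ultimately have r: "r \<in> borel_measurable M"
    using domain_sets_lebesgue by (rule borel_measurable_lebesgue_on_cong_AE)
  obtain C where "AE x in M. norm (q x) \<le> C"
    using Mh_ess_bounded[OF assms(1)] by (auto simp: ess_bounded_def)
  with eq have "AE x in M. norm (r x) \<le> C" by eventually_elim simp
  with r have "r \<in> L2_space \<Omega>" by (intro ess_bounded_L2_space ess_boundedI)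
  moreover have "\<exists>s\<in>MT T. AE x in M. x \<in> T \<longrightarrow> r x = s x" if T: "T \<in> \<T>" for T
  proof -
    obtain s where "s \<in> MT T" and s: "AE x in M. x \<in> T \<longrightarrow> q x = s x"
      using assms T unfolding Mh fe_pressure_space_def by blast
    from s eq have "AE x in M. x \<in> T \<longrightarrow> r x = s x" by eventually_elim simp
    then show ?thesis using \<open>s \<in> MT T\<close> by blast
  qed
  ultimately show ?thesis by (simp add: Mh fe_pressure_space_def)
qed

lemma Xh_add_scaleR:
  assumes "v \<in> Xh" and "w \<in> Xh"
  shows "(\<lambda>x. v x + t *\<^sub>R w x) \<in> Xh"
proof -
  obtain XT where XT: "\<And>T. T \<in> \<T> \<Longrightarrow> local_polynomial_space (XT T)"
    and Xh: "Xh = fe_velocity_space \<Omega> \<T> XT" using velocity_local_spaces by blast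
  have "\<exists>s\<in>XT T. AE x in M. x \<in> T \<longrightarrow> v x + t *\<^sub>R w x = s x" if T: "T \<in> \<T>" for T
  proof -
    obtain a b where ab: "a \<in> XT T" "b \<in> XT T"
      and a: "AE x in M. x \<in> T \<longrightarrow> v x = a x" and b: "AE x in M. x \<in> T \<longrightarrow> w x = b x"
      using assms T unfolding Xh fe_velocity_space_def by blast
    from a b have "AE x in M. x \<in> T \<longrightarrow> v x + t *\<^sub>R w x = a x + t *\<^sub>R b x"
      by eventually_elim simp
    then show ?thesis
      by (rule bexI[where x = "\<lambda>x. a x + t *\<^sub>R b x"])
         (rule local_polynomial_space_add_scaleR[OF XT[OF T] ab])
  qed
  moreover have "(\<lambda>x. v x + t *\<^sub>R w x) \<in> L3_space \<Omega>"
    using assms by (intro ess_bounded_L3_space ess_bounded_add ess_bounded_scaleR ess_bounded_const Xh_ess_bounded)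
  moreover have "(\<lambda>x. wdiv \<Omega> v x + t * wdiv \<Omega> w x) \<in> L2_space \<Omega>"
    using assms by (intro ess_bounded_L2_space Mh_ess_bounded Mh_add_scale wdiv_in_Mh)
  moreover have "is_weak_div \<Omega> (\<lambda>x. v x + t *\<^sub>R w x) (\<lambda>x. wdiv \<Omega> v x + t * wdiv \<Omega> w x)"
    using assms
    by (intro is_weak_div_add_scaleR Xh_ess_bounded wdiv_ess_bounded wdiv_is_weak_div Xh_X_space)
  ultimately show ?thesis by (auto simp: Xh fe_velocity_space_def X_space_def)
qed

lemma Xh_diff: "v \<in> Xh \<Longrightarrow> w \<in> Xh \<Longrightarrow> (\<lambda>x. v x - w x) \<in> Xh"
  using Xh_add_scaleR[of v w "- 1"] by simp

section \<open>Uniqueness and linearity of the discrete weak divergence\<close>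

text \<open>The fundamental lemma of the calculus of variations, made elementary by continuity of
  the local polynomial: where it is nonzero it keeps its sign on a small ball, and a bump function
  there gives a nonzero integral.\<close>

lemma Mh_eq_0_if_test_functions:
  assumes "q \<in> Mh" and "\<And>\<phi>. test_function \<Omega> \<phi> \<Longrightarrow> (LINT x|M. q x * \<phi> x) = 0"
  shows "AE x in M. q x = 0"
proof -
  obtain MT where MT: "\<And>T. T \<in> \<T> \<Longrightarrow> local_polynomial_space (MT T)"
    and Mh: "Mh = fe_pressure_space \<Omega> \<T> MT" using pressure_local_spaces by blast
  have "AE x in M. x \<in> interior T \<longrightarrow> q x = 0" if T: "T \<in> \<T>" for T
  proof -
    obtain r where "r \<in> MT T" and r: "AE x in M. x \<in> T \<longrightarrow> q x = r x"
      using assms T unfolding Mh fe_pressure_space_def by blast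
    then have "polynomial_function r" using MT[OF T] by (auto simp: local_polynomial_space_def)
    then have cont: "isCont r x" for x by (rule continuous_polymonial_function)
    have zero: "r a = 0" if a: "a \<in> interior T" for a
    proof (rule ccontr)
      assume nz: "r a \<noteq> 0"
      \<comment> \<open>Multiplying by the value \<open>r a\<close> makes the product positive near
        \<open>a\<close> and so treats both signs at once.\<close>
      have "((\<lambda>x. r a * r x) \<longlongrightarrow> r a * r a) (nhds a)"
        using cont[of a] by (intro tendsto_mult tendsto_const)
          (simp add: isCont_def tendsto_at_iff_tendsto_nhds)
      moreover have "r a * r a > 0" using nz by (auto simp: zero_less_mult_iff)
      ultimately have "\<forall>\<^sub>F x in nhds a. r a * r x > 0"
        by (rule order_tendstoD)
      then obtain e where e: "e > 0" "\<And>x. dist x a < e \<Longrightarrow> r a * r x > 0"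
        by (auto simp: eventually_nhds_metric)
      obtain d where d: "d > 0" "cball a d \<subseteq> interior T"
        using open_contains_cball[of "interior T"] a by auto
      define \<delta> where "\<delta> = min d e"
      have \<delta>: "\<delta> > 0" "cball a \<delta> \<subseteq> interior T" "\<And>x. x \<in> ball a \<delta> \<Longrightarrow> r a * r x > 0"
        using d e by (auto simp: \<delta>_def dist_commute subset_eq)
      have sub: "cball a \<delta> \<subseteq> \<Omega>" using \<delta>(2) partitionD(4)[OF T] by blast
      obtain \<phi> where \<phi>: "test_function \<Omega> \<phi>" "\<And>x. x \<in> ball a \<delta> \<Longrightarrow> \<phi> x > 0"
        "\<And>x. x \<notin> ball a \<delta> \<Longrightarrow> \<phi> x = 0"
        using exists_bump_function[OF \<delta>(1) sub] by blast
      have pos: "AE x in M. r a * (q x * \<phi> x) \<ge> 0 \<and> (x \<in> ball a \<delta> \<longrightarrow> r a * (q x * \<phi> x) > 0)"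
        using r
      proof eventually_elim
        case (elim x)
        show ?case
        proof (cases "x \<in> ball a \<delta>")
          case True
          then have "x \<in> T" using \<delta>(2) interior_subset by (meson ball_subset_cball subsetD)
          then have "r a * (q x * \<phi> x) = r a * r x * \<phi> x" using elim by simp
          moreover have "\<dots> > 0" using \<delta>(3)[OF True] \<phi>(2)[OF True] by (rule mult_pos_pos)
          ultimately have "r a * (q x * \<phi> x) > 0" by (simp only:)
          then show ?thesis by (intro conjI impI less_imp_le)
        qed (simp add: \<phi>(3))
      qed
      have "integrable M (\<lambda>x. r a * (q x * \<phi> x))"
        by (intro integrable_ess_bounded ess_bounded_mult ess_bounded_const
            Mh_ess_bounded test_function_ess_bounded[OF \<phi>(1)] assms)
      moreover have "(LINT x|M. r a * (q x * \<phi> x)) = 0" using assms(2)[OF \<phi>(1)] by simp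
      moreover have "AE x in M. 0 \<le> r a * (q x * \<phi> x)" using pos by eventually_elim simp
      ultimately have "AE x in M. r a * (q x * \<phi> x) = 0"
        by (simp only: integral_nonneg_eq_0_iff_AE)
      \<comment> \<open>The vanishing integrand is strictly positive on the ball, so the ball would
        be a null set, impossible for a nonempty open set.\<close>
      with pos have "AE x in M. x \<notin> ball a \<delta>" by eventually_elim auto
      then have "AE x in lebesgue. x \<in> \<Omega> \<longrightarrow> x \<notin> ball a \<delta>"
        using domain_sets_lebesgue by (subst (asm) AE_restrict_space_iff) auto
      then have "AE x in lebesgue. x \<notin> ball a \<delta>"
        by eventually_elim (use sub ball_subset_cball in blast)
      then have "ball a \<delta> \<in> null_sets lebesgue"
        by (simp add: completion.null_sets_iff_AE)
      then show False
        using open_not_negligible[of "ball a \<delta>"] \<delta>(1) by (simp add: negligible_iff_null_sets)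
    qed
    from r show ?thesis
      by eventually_elim (use zero interior_subset in force)
  qed
  then have "AE x in M. \<forall>T\<in>\<T>. x \<in> interior T \<longrightarrow> q x = 0"
    by (intro AE_finite_allI partitionD(1))
  with AE_in_element show ?thesis by eventually_elim blast
qed

text \<open>\<open>wdiv\<close> is an arbitrary choice of representative, so linearity can only hold
  almost everywhere. Both sides are weak divergences of the same field and lie in \<open>Mh\<close>;
  their difference therefore annihilates all test functions.\<close>

lemma wdiv_add_scaleR:
  assumes "v \<in> Xh" and "w \<in> Xh"
  shows "AE x in M. wdiv \<Omega> (\<lambda>x. v x + t *\<^sub>R w x) x = wdiv \<Omega> v x + t * wdiv \<Omega> w x"
proof -
  define a where "a = wdiv \<Omega> (\<lambda>x. v x + t *\<^sub>R w x)"
  define b where "b = (\<lambda>x. wdiv \<Omega> v x + t * wdiv \<Omega> w x)"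
  have a: "a \<in> Mh" "is_weak_div \<Omega> (\<lambda>x. v x + t *\<^sub>R w x) a"
    unfolding a_def by (intro wdiv_in_Mh wdiv_is_weak_div Xh_X_space Xh_add_scaleR assms)+
  have b: "b \<in> Mh" "is_weak_div \<Omega> (\<lambda>x. v x + t *\<^sub>R w x) b"
    unfolding b_def
    by (intro Mh_add_scale wdiv_in_Mh is_weak_div_add_scaleR Xh_ess_bounded wdiv_ess_bounded
        wdiv_is_weak_div Xh_X_space assms)+
  have "AE x in M. a x - b x = 0"
  proof (rule Mh_eq_0_if_test_functions)
    show "(\<lambda>x. a x - b x) \<in> Mh" using a b by (intro Mh_diff)
    fix \<phi> assume \<phi>: "test_function \<Omega> \<phi>"
    have "integrable M (\<lambda>x. a x * \<phi> x)" "integrable M (\<lambda>x. b x * \<phi> x)"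
      by (intro integrable_ess_bounded ess_bounded_mult Mh_ess_bounded a b
          test_function_ess_bounded[OF \<phi>])+
    then show "(LINT x|M. (a x - b x) * \<phi> x) = 0"
      using a(2) b(2) \<phi> by (simp add: is_weak_div_def left_diff_distrib)
  qed
  then show ?thesis unfolding a_def b_def by eventually_elim simp
qed

section \<open>Finite dimension and control of pressures by divergences\<close>

text \<open>The generators are the local ones, extended by zero outside their element. Indices are
  pairs of an element and a polynomial, since the same polynomial may occur on several
  elements.\<close>

lemma Mh_finite_span:
  obtains J :: "((real ^ 'd) set \<times> (real ^ 'd \<Rightarrow> real)) set" and b
  where "finite J" and "\<And>j. j \<in> J \<Longrightarrow> b j \<in> Mh"
    and "\<And>e. e \<in> Mh \<Longrightarrow> \<exists>c. AE x in M. e x = (\<Sum>j\<in>J. c j * b j x)"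
proof -
  obtain MT where MT: "\<And>T. T \<in> \<T> \<Longrightarrow> local_polynomial_space (MT T)"
    and Mh: "Mh = fe_pressure_space \<Omega> \<T> MT" using pressure_local_spaces by blast
  have "\<exists>B. finite B \<and> MT T = fn_span B" if "T \<in> \<T>" for T
    using MT[OF that] by (auto simp: local_polynomial_space_def)
  then obtain B where B: "\<And>T. T \<in> \<T> \<Longrightarrow> finite (B T)" "\<And>T. T \<in> \<T> \<Longrightarrow> MT T = fn_span (B T)"
    by metis
  \<comment> \<open>Cutting off at the interior rather than at \<open>T\<close> makes the supports
    of different elements disjoint at every point; for points in some interior only one block of the
    sum survives.\<close>
  define b where "b = (\<lambda>(T :: (real ^ 'd) set, p) x. if x \<in> interior T then p x else (0::real))"
  show thesis
  proof (rule that[of "Sigma \<T> B" b])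
    show "finite (Sigma \<T> B)" using B(1) partitionD(1) by auto
  next
    fix j assume "j \<in> Sigma \<T> B"
    then obtain T p where j: "j = (T, p)" and T: "T \<in> \<T>" and p: "p \<in> B T" by auto
    have "p \<in> MT T" using fn_span_base[OF B(1)[OF T] p] B(2)[OF T] by simp
    then have poly: "polynomial_function p" using MT[OF T] by (auto simp: local_polynomial_space_def)
    have *: "\<exists>r\<in>MT S. polynomial_function r \<and> (AE x in M. x \<in> S \<longrightarrow> b j x = r x)" if S: "S \<in> \<T>" for S
    proof (cases "S = T")
      case True
      have "AE x in M. x \<in> S \<longrightarrow> b j x = p x"
        using AE_element_interior[OF T] by eventually_elim (simp add: True j b_def)
      then show ?thesis using True \<open>p \<in> MT T\<close> poly by blast
    next
      case False
      have "AE x in M. x \<in> S \<longrightarrow> b j x = 0"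
        using AE_element_interior[OF S]
        by eventually_elim (use partitionD(5)[OF S T False] in \<open>auto simp: j b_def\<close>)
      moreover have "(\<lambda>x. 0) \<in> MT S" using fn_span_zero B(2)[OF S] by simp
      ultimately show ?thesis by (intro bexI[of _ "\<lambda>x. 0"]) auto
    qed
    have "ess_bounded M p"
      using poly by (intro ess_bounded_continuous continuous_on_polymonial_function)
    then have "p \<in> borel_measurable M" by (rule ess_bounded_measurable)
    moreover have "interior T \<inter> space M \<in> sets M"
      using domain_sets_lebesgue by (auto simp: sets_restrict_space_iff intro!: sets.Int borel_open)
    ultimately have "b j \<in> borel_measurable M"
      unfolding j b_def by (auto intro!: measurable_If_set)
    then have "ess_bounded M (b j)"
    proof (rule ess_bounded_piecewise_polynomial)
      fix S assume "S \<in> \<T>"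
      from *[OF this] show "\<exists>r. polynomial_function r \<and> (AE x in M. x \<in> S \<longrightarrow> b j x = r x)"
        by (elim bexE) (rule exI)
    qed
    then have "b j \<in> L2_space \<Omega>" by (rule ess_bounded_L2_space)
    then show "b j \<in> Mh" using * by (auto simp: Mh fe_pressure_space_def)
  next
    fix e assume "e \<in> Mh"
    have "\<forall>T\<in>\<T>. \<exists>c. AE x in M. x \<in> T \<longrightarrow> e x = (\<Sum>p\<in>B T. c p * p x)"
    proof
      fix T assume T: "T \<in> \<T>"
      show "\<exists>c. AE x in M. x \<in> T \<longrightarrow> e x = (\<Sum>p\<in>B T. c p * p x)"
        using \<open>e \<in> Mh\<close> T B(2)[OF T] by (fastforce simp: Mh fe_pressure_space_def fn_span_def)
    qed
    from bchoice[OF this] obtain c where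
      "\<forall>T\<in>\<T>. AE x in M. x \<in> T \<longrightarrow> e x = (\<Sum>p\<in>B T. c T p * p x)" ..
    then have "AE x in M. \<forall>T\<in>\<T>. x \<in> T \<longrightarrow> e x = (\<Sum>p\<in>B T. c T p * p x)"
      using partitionD(1) by (simp add: AE_finite_all)
    with AE_in_element have "AE x in M. e x = (\<Sum>j\<in>Sigma \<T> B. (case j of (T, p) \<Rightarrow> c T p) * b j x)"
    proof eventually_elim
      case (elim x)
      then obtain T where T: "T \<in> \<T>" "x \<in> interior T" by blast
      have "(\<Sum>j\<in>Sigma \<T> B. (case j of (T, p) \<Rightarrow> c T p) * b j x)
          = (\<Sum>S\<in>\<T>. \<Sum>p\<in>B S. c S p * (if x \<in> interior S then p x else 0))"
        using partitionD(1) B(1) by (subst sum.Sigma) (auto simp: b_def intro!: sum.cong)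
      also have "\<dots> = (\<Sum>S\<in>\<T>. if S = T then e x else 0)"
      proof (rule sum.cong)
        fix S assume S: "S \<in> \<T>"
        show "(\<Sum>p\<in>B S. c S p * (if x \<in> interior S then p x else 0)) = (if S = T then e x else 0)"
        proof (cases "S = T")
          case True
          have "x \<in> T" using T(2) interior_subset by blast
          then show ?thesis using True T elim(2)[rule_format, of T] by simp
        next
          case False
          then have "x \<notin> interior S" using partitionD(5)[OF S T(1)] T(2) by blast
          then show ?thesis using False by simp
        qed
      qed simp
      also have "\<dots> = e x" using T partitionD(1) by simp
      finally show ?case by simp
    qed
    then show "\<exists>c. AE x in M. e x = (\<Sum>j\<in>Sigma \<T> B. c j * b j x)" by blast
  qed
qed

text \<open>This plays the role of a discrete inf-sup condition. By \<open>div_onto_Mh\<close> the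
  generators of \<open>Mh\<close> are divergences of fixed velocities, and
  \<open>psd_gram_bound\<close> for their Gram matrix bounds the norm by the moments. Finitely many
  fixed velocities suffice, which suits \<open>DF_form_continuous\<close>.\<close>

lemma Mh_norm_bound_by_divergences:
  obtains C and J :: "((real ^ 'd) set \<times> (real ^ 'd \<Rightarrow> real)) set" and v
  where "C \<ge> 0" and "finite J" and "\<And>j. j \<in> J \<Longrightarrow> v j \<in> Xh"
    and "\<And>e. e \<in> Mh \<Longrightarrow> (LINT x|M. (e x)\<^sup>2) \<le> C * (\<Sum>j\<in>J. (LINT x|M. e x * wdiv \<Omega> (v j) x)\<^sup>2)"
proof -
  obtain J :: "((real ^ 'd) set \<times> (real ^ 'd \<Rightarrow> real)) set" and b where J: "finite J"
    and b: "\<And>j. j \<in> J \<Longrightarrow> b j \<in> Mh"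
    and span: "\<And>e. e \<in> Mh \<Longrightarrow> \<exists>c. AE x in M. e x = (\<Sum>j\<in>J. c j * b j x)"
    using Mh_finite_span by blast
  have eb: "ess_bounded M (b j)" if "j \<in> J" for j using b[OF that] by (rule Mh_ess_bounded)
  have "\<forall>j\<in>J. \<exists>v. v \<in> Xh \<and> (AE x in M. wdiv \<Omega> v x = b j x)"
    using b div_onto_Mh by metis
  then obtain v where v: "\<And>j. j \<in> J \<Longrightarrow> v j \<in> Xh" "\<And>j. j \<in> J \<Longrightarrow> AE x in M. wdiv \<Omega> (v j) x = b j x"
    by metis
  define G where "G i j = (LINT x|M. b i x * b j x)" for i j
  define L where "L c x = (\<Sum>j\<in>J. c j * b j x)" for c x
  have L: "ess_bounded M (L c)" for c
    unfolding L_def[abs_def] by (intro ess_bounded_sum ess_bounded_mult ess_bounded_const eb)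
  have GL: "(\<Sum>i\<in>J. c i * G i j) = (LINT x|M. L c x * b j x)" if "j \<in> J" for c j
  proof -
    have "(LINT x|M. L c x * b j x) = (LINT x|M. (\<Sum>i\<in>J. c i * (b i x * b j x)))"
      by (simp add: L_def sum_distrib_right mult.assoc)
    also have "\<dots> = (\<Sum>i\<in>J. LINT x|M. c i * (b i x * b j x))"
      by (rule Bochner_Integration.integral_sum)
         (intro integrable_ess_bounded ess_bounded_mult ess_bounded_const eb that)
    finally show ?thesis by (simp add: G_def)
  qed
  \<comment> \<open>In the Gram bound the quadratic form is the squared norm of the combination
    \<open>L c\<close>, while by \<open>GL\<close> the entries of the matrix-vector product are its
    moments.\<close>
  have GLL: "(\<Sum>j\<in>J. c j * (\<Sum>i\<in>J. c i * G i j)) = (LINT x|M. (L c x)\<^sup>2)" for c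
  proof -
    have "(LINT x|M. (L c x)\<^sup>2) = (LINT x|M. (\<Sum>j\<in>J. c j * (L c x * b j x)))"
      by (rule Bochner_Integration.integral_cong)
         (auto simp: power2_eq_square sum_distrib_left L_def[of c, symmetric] mult.assoc mult.left_commute
           intro!: sum.cong, simp add: L_def sum_distrib_left mult_ac)
    also have "\<dots> = (\<Sum>j\<in>J. LINT x|M. c j * (L c x * b j x))"
      by (rule Bochner_Integration.integral_sum)
         (intro integrable_ess_bounded ess_bounded_mult ess_bounded_const eb L)
    finally show ?thesis by (simp add: GL)
  qed
  have "G i j = G j i" for i j by (simp add: G_def mult.commute)
  moreover have "0 \<le> (\<Sum>j\<in>J. c j * (\<Sum>i\<in>J. c i * G i j))" for c by (simp add: GLL)
  ultimately obtain C where "C \<ge> 0"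
    and C: "\<And>c. (\<Sum>j\<in>J. c j * (\<Sum>i\<in>J. c i * G i j)) \<le> C * (\<Sum>j\<in>J. (\<Sum>i\<in>J. c i * G i j)\<^sup>2)"
    using psd_gram_bound[OF J, of G] by blast
  show thesis
  proof (rule that[OF \<open>C \<ge> 0\<close> J v(1)])
    fix e assume e: "e \<in> Mh"
    then obtain c where "AE x in M. e x = (\<Sum>j\<in>J. c j * b j x)" using span by blast
    then have c: "AE x in M. e x = L c x" by (simp add: L_def)
    have meas: "e \<in> borel_measurable M" "L c \<in> borel_measurable M"
      using Mh_ess_bounded[OF e] L by (auto intro: ess_bounded_measurable)
    have "(LINT x|M. (e x)\<^sup>2) = (LINT x|M. (L c x)\<^sup>2)"
      by (rule integral_cong_AE) (use c meas in auto)
    moreover have "(LINT x|M. e x * wdiv \<Omega> (v j) x) = (LINT x|M. L c x * b j x)" if j: "j \<in> J" for j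
    proof (rule integral_cong_AE)
      show "AE x in M. e x * wdiv \<Omega> (v j) x = L c x * b j x"
        using c v(2)[OF j] by eventually_elim simp
    qed (intro borel_measurable_times meas ess_bounded_measurable wdiv_ess_bounded eb v(1) j)+
    ultimately show "(LINT x|M. (e x)\<^sup>2) \<le> C * (\<Sum>j\<in>J. (LINT x|M. e x * wdiv \<Omega> (v j) x)\<^sup>2)"
      using C[of c, unfolded GLL] by (simp add: GL)
  qed
qed

end

section \<open>Convergence of the augmented Lagrangian method\<close>

locale discrete_DF = DF_data \<Omega> \<mu> \<rho> \<beta> K + RT_pair \<Omega> \<T> Xh Mh
  for \<Omega> :: "(real ^ 'd) set" and \<mu> \<rho> \<beta> K \<T> Xh Mh +
  fixes f :: "real ^ 'd \<Rightarrow> real ^ 'd"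
  assumes load: "bounded_load \<Omega> f"
begin

abbreviation "F \<equiv> DF_energy \<Omega> \<mu> \<rho> \<beta> K f"
abbreviation "a \<equiv> DF_form \<Omega> \<mu> \<rho> \<beta> K"

lemma integrable_load: "v \<in> Xh \<Longrightarrow> integrable M (\<lambda>x. f x \<bullet> v x)"
  using load Xh_X_space by (simp add: bounded_load_def)

section \<open>Bregman divergence and optimality on the discrete space\<close>

lemma energy_has_derivative:
  assumes "v \<in> Xh" and "w \<in> Xh"
  shows "((\<lambda>t. F (\<lambda>x. v x + t *\<^sub>R w x)) has_real_derivative a v w - (LINT x|M. f x \<bullet> w x)) (at 0)"
  using assms by (intro DF_energy_has_derivative Xh_ess_bounded integrable_load)

lemma bregman_sym_energy:
  assumes "v \<in> Xh" and "w \<in> Xh"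
  shows "bregman_sym F v w = a v (\<lambda>x. v x - w x) - a w (\<lambda>x. v x - w x)"
  using energy_has_derivative[OF assms(1) Xh_diff[OF assms]]
    energy_has_derivative[OF assms(2) Xh_diff[OF assms]]
  by (simp add: bregman_sym_def gateaux_deriv_def DERIV_imp_deriv)

text \<open>The objective is stationary at its minimiser, and the pressure and penalty contributions
  to the derivative combine into the updated multiplier \<open>p'\<close>. The penalty parameter
  thereby disappears from the equation.\<close>

lemma augmented_Lagrangian_optimality:
  assumes min: "is_arg_min (\<lambda>v. F v - (LINT x|M. p x * wdiv \<Omega> v x)
      + 1 / (2 * \<epsilon>) * (LINT x|M. (wdiv \<Omega> v x - gh x)\<^sup>2)) (\<lambda>v. v \<in> Xh) u"
    and p: "p \<in> Mh" and gh: "gh \<in> Mh" and p': "p' \<in> Mh"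
    and upd: "AE x in M. p' x = p x - inverse \<epsilon> * (wdiv \<Omega> u x - gh x)"
    and v: "v \<in> Xh"
  shows "a u v - (LINT x|M. f x \<bullet> v x) = (LINT x|M. p' x * wdiv \<Omega> v x)"
proof -
  have u: "u \<in> Xh" using min by (simp add: is_arg_min_def)
  define du where "du = wdiv \<Omega> u"
  define dv where "dv = wdiv \<Omega> v"
  have eb: "ess_bounded M du" "ess_bounded M dv" "ess_bounded M p" "ess_bounded M gh" "ess_bounded M p'"
    unfolding du_def dv_def by (intro wdiv_ess_bounded Mh_ess_bounded u v p gh p')+
  note eb = ess_bounded_intros eb
  have int: "integrable M (\<lambda>x. p x * du x)" "integrable M (\<lambda>x. p x * dv x)" "integrable M (\<lambda>x. (du x - gh x)\<^sup>2)"
    "integrable M (\<lambda>x. (du x - gh x) * dv x)" "integrable M (\<lambda>x. (dv x)\<^sup>2)"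
    by (intro integrable_ess_bounded eb)+
  \<comment> \<open>\<open>\<Phi>\<close> is the objective along the line through \<open>u\<close>
    in direction \<open>v\<close>, with the divergence terms already expanded into polynomials in
    \<open>t\<close>; this bypasses differentiating the a.e. defined \<open>wdiv\<close>.\<close>
  define \<Phi> where "\<Phi> t = F (\<lambda>x. u x + t *\<^sub>R v x) - ((LINT x|M. p x * du x) + t * (LINT x|M. p x * dv x))
      + 1 / (2 * \<epsilon>) * ((LINT x|M. (du x - gh x)\<^sup>2) + 2 * t * (LINT x|M. (du x - gh x) * dv x)
        + t\<^sup>2 * (LINT x|M. (dv x)\<^sup>2))" for t
  have \<Phi>: "F w - (LINT x|M. p x * wdiv \<Omega> w x) + 1 / (2 * \<epsilon>) * (LINT x|M. (wdiv \<Omega> w x - gh x)\<^sup>2) = \<Phi> t"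
    and w_Xh: "w \<in> Xh" if w: "w = (\<lambda>x. u x + t *\<^sub>R v x)" for w t
  proof -
    show "w \<in> Xh" unfolding w by (rule Xh_add_scaleR[OF u v])
    then have dw: "ess_bounded M (wdiv \<Omega> w)" by (rule wdiv_ess_bounded)
    have lin: "AE x in M. wdiv \<Omega> w x = du x + t * dv x"
      using wdiv_add_scaleR[OF u v, of t] by (simp add: w du_def dv_def)
    have "(LINT x|M. p x * wdiv \<Omega> w x) = (LINT x|M. p x * du x + t * (p x * dv x))"
    proof (rule integral_cong_AE)
      show "AE x in M. p x * wdiv \<Omega> w x = p x * du x + t * (p x * dv x)"
        using lin by eventually_elim (simp add: algebra_simps)
    qed (intro ess_bounded_measurable eb dw)+
    moreover have "(LINT x|M. (wdiv \<Omega> w x - gh x)\<^sup>2)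
        = (LINT x|M. (du x - gh x)\<^sup>2 + 2 * t * ((du x - gh x) * dv x) + t\<^sup>2 * (dv x)\<^sup>2)"
    proof (rule integral_cong_AE)
      show "AE x in M. (wdiv \<Omega> w x - gh x)\<^sup>2
          = (du x - gh x)\<^sup>2 + 2 * t * ((du x - gh x) * dv x) + t\<^sup>2 * (dv x)\<^sup>2"
        using lin by eventually_elim (simp add: power2_eq_square algebra_simps)
    qed (intro ess_bounded_measurable eb dw)+
    ultimately show "F w - (LINT x|M. p x * wdiv \<Omega> w x)
        + 1 / (2 * \<epsilon>) * (LINT x|M. (wdiv \<Omega> w x - gh x)\<^sup>2) = \<Phi> t"
      using int by (simp add: \<Phi>_def w)
  qed
  have "\<Phi> 0 \<le> \<Phi> t" for t
    using min \<Phi>[OF refl, of t] \<Phi>[of u 0] w_Xh[OF refl, of t]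
    by (auto simp: is_arg_min_def not_less)
  moreover have "(\<Phi> has_real_derivative a u v - (LINT x|M. f x \<bullet> v x) - (LINT x|M. p x * dv x)
      + 1 / (2 * \<epsilon>) * (2 * (LINT x|M. (du x - gh x) * dv x))) (at 0)"
    unfolding \<Phi>_def[abs_def]
    by (rule derivative_eq_intros energy_has_derivative u v refl | simp)+
  ultimately have "a u v - (LINT x|M. f x \<bullet> v x) - (LINT x|M. p x * dv x)
      + 1 / (2 * \<epsilon>) * (2 * (LINT x|M. (du x - gh x) * dv x)) = 0"
    using DERIV_local_min[of \<Phi> _ 0 1] by simp
  \<comment> \<open>No sign of \<open>\<epsilon>\<close> is assumed here; at 0 both sides vanish by
    the convention for division.\<close>
  moreover have "1 / (2 * \<epsilon>) * (2 * (LINT x|M. (du x - gh x) * dv x)) = inverse \<epsilon> * (LINT x|M. (du x - gh x) * dv x)"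
    by (cases "\<epsilon> = 0") (simp_all add: field_simps)
  moreover have "(LINT x|M. p' x * dv x) = (LINT x|M. p x * dv x - inverse \<epsilon> * ((du x - gh x) * dv x))"
  proof (rule integral_cong_AE)
    show "AE x in M. p' x * dv x = p x * dv x - inverse \<epsilon> * ((du x - gh x) * dv x)"
      using upd by eventually_elim (simp only: du_def, simp add: algebra_simps)
  qed (intro ess_bounded_measurable eb)+
  then have "(LINT x|M. p' x * dv x) = (LINT x|M. p x * dv x) - inverse \<epsilon> * (LINT x|M. (du x - gh x) * dv x)"
    using int by simp
  ultimately show ?thesis unfolding dv_def by linarith
qed

section \<open>A lower bound for the divergence uniform in the penalty parameter\<close>

text \<open>The multiplier error \<open>e\<close> is tied to \<open>u\<close> only by the residual
  equation, in which \<open>\<epsilon>\<close> does not occur. Hence \<open>m\<close> depends on the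
  data, \<open>uh\<close> and \<open>R\<close> alone, and this is the source of the independence of
  \<open>\<epsilon>\<close>.\<close>

lemma bregman_bounds_multiplier:
  assumes uh: "uh \<in> Xh" and "R \<ge> 0"
  obtains m where "m > 0"
    and "\<And>u e. u \<in> Xh \<Longrightarrow> e \<in> Mh \<Longrightarrow> (LINT x|M. (e x)\<^sup>2) \<le> R \<Longrightarrow>
      (\<And>v. v \<in> Xh \<Longrightarrow> a u v - a uh v = (LINT x|M. e x * wdiv \<Omega> v x)) \<Longrightarrow>
      m * (LINT x|M. (e x)\<^sup>2) \<le> a u (\<lambda>x. u x - uh x) - a uh (\<lambda>x. u x - uh x)"
proof -
  obtain c where "c > 0" and coercive: "\<And>u v. ess_bounded M u \<Longrightarrow> ess_bounded M v \<Longrightarrow>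
      c * (LINT x|M. (norm (u x - v x))\<^sup>2) \<le> a u (\<lambda>x. u x - v x) - a v (\<lambda>x. u x - v x)"
    using DF_form_coercive by blast
  obtain C and J :: "((real ^ 'd) set \<times> (real ^ 'd \<Rightarrow> real)) set" and v
    where "C \<ge> 0" and J: "finite J" and v: "\<And>j. j \<in> J \<Longrightarrow> v j \<in> Xh"
      and C: "\<And>e. e \<in> Mh \<Longrightarrow> (LINT x|M. (e x)\<^sup>2) \<le> C * (\<Sum>j\<in>J. (LINT x|M. e x * wdiv \<Omega> (v j) x)\<^sup>2)"
    using Mh_norm_bound_by_divergences by blast
  have "\<forall>j\<in>J. \<exists>B\<ge>0. \<forall>u. ess_bounded M u \<longrightarrow> \<bar>a u (v j) - a uh (v j)\<bar>
      \<le> B * (sqrt (LINT x|M. (norm (u x - uh x))\<^sup>2) + (LINT x|M. (norm (u x - uh x))\<^sup>2))"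
  proof
    fix j assume "j \<in> J"
    from DF_form_continuous[OF Xh_ess_bounded[OF uh] Xh_ess_bounded[OF v[OF this]]]
    obtain b where "b \<ge> 0" "\<And>u. ess_bounded M u \<Longrightarrow> \<bar>a u (v j) - a uh (v j)\<bar>
        \<le> b * (sqrt (LINT x|M. (norm (u x - uh x))\<^sup>2) + (LINT x|M. (norm (u x - uh x))\<^sup>2))"
      by blast
    then show "\<exists>B\<ge>0. \<forall>u. ess_bounded M u \<longrightarrow> \<bar>a u (v j) - a uh (v j)\<bar>
        \<le> B * (sqrt (LINT x|M. (norm (u x - uh x))\<^sup>2) + (LINT x|M. (norm (u x - uh x))\<^sup>2))"
      by (intro exI[of _ b] conjI allI impI)
  qed
  from bchoice[OF this] obtain B where "\<forall>j\<in>J. B j \<ge> 0 \<and> (\<forall>u. ess_bounded M u \<longrightarrow> \<bar>a u (v j) - a uh (v j)\<bar>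
      \<le> B j * (sqrt (LINT x|M. (norm (u x - uh x))\<^sup>2) + (LINT x|M. (norm (u x - uh x))\<^sup>2)))"
    ..
  then have B: "\<And>j u. j \<in> J \<Longrightarrow> ess_bounded M u \<Longrightarrow> \<bar>a u (v j) - a uh (v j)\<bar>
      \<le> B j * (sqrt (LINT x|M. (norm (u x - uh x))\<^sup>2) + (LINT x|M. (norm (u x - uh x))\<^sup>2))"
    by blast
  define S where "S = C * (\<Sum>j\<in>J. (B j)\<^sup>2)"
  have "S \<ge> 0" using \<open>C \<ge> 0\<close> by (simp add: S_def sum_nonneg)
  \<comment> \<open>The denominator serves both regimes of \<open>W\<close>: \<open>4 * S\<close>
    for \<open>W \<le> 1\<close> and \<open>R\<close> for \<open>W > 1\<close>; the summand 1 keeps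
    it positive.\<close>
  define m where "m = c / (4 * S + R + 1)"
  have den: "4 * S + R + 1 > 0" using \<open>S \<ge> 0\<close> \<open>R \<ge> 0\<close> by simp
  show thesis
  proof (rule that[of m])
    show "m > 0" using \<open>c > 0\<close> den by (simp add: m_def)
    fix u e assume u: "u \<in> Xh" and e: "e \<in> Mh" and R: "(LINT x|M. (e x)\<^sup>2) \<le> R"
      and res: "\<And>v. v \<in> Xh \<Longrightarrow> a u v - a uh v = (LINT x|M. e x * wdiv \<Omega> v x)"
    define W where "W = (LINT x|M. (norm (u x - uh x))\<^sup>2)"
    define N where "N = (LINT x|M. (e x)\<^sup>2)"
    have "W \<ge> 0" by (simp add: W_def)
    have D: "c * W \<le> a u (\<lambda>x. u x - uh x) - a uh (\<lambda>x. u x - uh x)"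
      unfolding W_def by (intro coercive Xh_ess_bounded u uh)
    have "N \<le> (4 * S + R + 1) * W"
    proof (cases "W \<le> 1")
      case True
      \<comment> \<open>For \<open>W \<le> 1\<close> the quadratic growth is absorbed by the linear
        one, and the squared continuity bound becomes a multiple of \<open>W\<close>.\<close>
      have "W \<le> sqrt W"
        using True \<open>W \<ge> 0\<close> by (intro real_le_rsqrt) (simp add: power2_eq_square mult_left_le)
      then have "(sqrt W + W)\<^sup>2 \<le> (2 * sqrt W)\<^sup>2"
        using \<open>W \<ge> 0\<close> by (intro power_mono) auto
      then have W4: "(sqrt W + W)\<^sup>2 \<le> 4 * W"
        using \<open>W \<ge> 0\<close> by (simp add: power_mult_distrib)
      have "(LINT x|M. e x * wdiv \<Omega> (v j) x)\<^sup>2 \<le> (B j)\<^sup>2 * (4 * W)" if j: "j \<in> J" for j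
      proof -
        have "\<bar>LINT x|M. e x * wdiv \<Omega> (v j) x\<bar> \<le> B j * (sqrt W + W)"
          using B[OF j Xh_ess_bounded[OF u]] res[OF v[OF j]] by (simp add: W_def)
        then have "(LINT x|M. e x * wdiv \<Omega> (v j) x)\<^sup>2 \<le> (B j * (sqrt W + W))\<^sup>2"
          by (metis abs_ge_zero power2_abs power_mono)
        also have "\<dots> \<le> (B j)\<^sup>2 * (4 * W)"
          unfolding power_mult_distrib using W4 by (intro mult_left_mono) auto
        finally show ?thesis .
      qed
      then have "(\<Sum>j\<in>J. (LINT x|M. e x * wdiv \<Omega> (v j) x)\<^sup>2) \<le> (\<Sum>j\<in>J. (B j)\<^sup>2 * (4 * W))"
        by (rule sum_mono)
      then have "C * (\<Sum>j\<in>J. (LINT x|M. e x * wdiv \<Omega> (v j) x)\<^sup>2) \<le> C * (\<Sum>j\<in>J. (B j)\<^sup>2 * (4 * W))"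
        using \<open>C \<ge> 0\<close> by (rule mult_left_mono)
      also have "\<dots> = 4 * S * W"
        by (simp only: S_def sum_distrib_right[symmetric])
      finally have "N \<le> 4 * S * W" using C[OF e] by (simp add: N_def)
      moreover have "0 \<le> (R + 1) * W" using \<open>R \<ge> 0\<close> \<open>W \<ge> 0\<close> by simp
      ultimately show ?thesis by (simp add: algebra_simps)
    next
      case False
      \<comment> \<open>For \<open>W > 1\<close> continuity is of no help; the a priori bound
        \<open>R\<close> on the multiplier error is below the constant and hence below its multiple
        by \<open>W\<close>.\<close>
      then have "(4 * S + R + 1) * 1 \<le> (4 * S + R + 1) * W" using den by (intro mult_left_mono) auto
      then show ?thesis using R \<open>S \<ge> 0\<close> by (simp add: N_def)
    qed
    then have "m * N \<le> m * ((4 * S + R + 1) * W)"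
      using \<open>m > 0\<close> by (intro mult_left_mono) auto
    also have "\<dots> = c * W" using den by (simp add: m_def)
    finally show "m * (LINT x|M. (e x)\<^sup>2) \<le> a u (\<lambda>x. u x - uh x) - a uh (\<lambda>x. u x - uh x)"
      using D by (simp add: N_def)
  qed
qed

text \<open>Since divergences of \<open>Xh\<close> lie in \<open>Mh\<close>, the difference of the
  two sides is an admissible test function; the mass equation and the projection property then make
  its norm zero.\<close>

lemma wdiv_discrete_solution:
  assumes "g \<in> L2_space \<Omega>" and proj: "is_L2_projection \<Omega> Mh g gh" and uh: "uh \<in> Xh"
    and div: "\<And>q. q \<in> Mh \<Longrightarrow> (LINT x|M. q x * wdiv \<Omega> uh x) = (LINT x|M. g x * q x)"
  shows "AE x in M. wdiv \<Omega> uh x = gh x"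
proof -
  have gh: "gh \<in> Mh" using proj by (simp add: is_L2_projection_def)
  define q where "q x = wdiv \<Omega> uh x - gh x" for x
  have q: "q \<in> Mh" unfolding q_def[abs_def] by (intro Mh_diff wdiv_in_Mh uh gh)
  have eb: "ess_bounded M q" "ess_bounded M gh" "ess_bounded M (wdiv \<Omega> uh)"
    by (intro Mh_ess_bounded q gh wdiv_in_Mh uh)+
  have gm: "g \<in> borel_measurable M" and g2: "integrable M (\<lambda>x. (g x)\<^sup>2)"
    using assms(1) by (auto simp: L2_space_def)
  have int: "integrable M (\<lambda>x. q x * gh x)" "integrable M (\<lambda>x. q x * wdiv \<Omega> uh x)" "integrable M (\<lambda>x. (q x)\<^sup>2)"
    by (intro integrable_ess_bounded ess_bounded_mult ess_bounded_power eb)+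
  \<comment> \<open>The source is only square integrable, not bounded, so the product is dominated
    by the sum of the squares.\<close>
  have gq: "integrable M (\<lambda>x. g x * q x)"
  proof (rule Bochner_Integration.integrable_bound)
    show "integrable M (\<lambda>x. (g x)\<^sup>2 + (q x)\<^sup>2)" using g2 int by simp
    show "(\<lambda>x. g x * q x) \<in> borel_measurable M"
      by (intro borel_measurable_times gm ess_bounded_measurable eb)
    have "\<bar>g x * q x\<bar> \<le> (g x)\<^sup>2 + (q x)\<^sup>2" for x
    proof -
      have "2 * (\<bar>g x\<bar> * \<bar>q x\<bar>) \<le> (g x)\<^sup>2 + (q x)\<^sup>2"
        using zero_le_power2[of "\<bar>g x\<bar> - \<bar>q x\<bar>"] by (simp add: power2_diff)
      moreover have "0 \<le> \<bar>g x\<bar> * \<bar>q x\<bar>" by simp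
      ultimately show ?thesis unfolding abs_mult by linarith
    qed
    then show "AE x in M. norm (g x * q x) \<le> norm ((g x)\<^sup>2 + (q x)\<^sup>2)" by simp
  qed
  have "(LINT x|M. (g x - gh x) * q x) = 0" using proj q by (simp add: is_L2_projection_def)
  moreover have "(LINT x|M. (g x - gh x) * q x) = (LINT x|M. g x * q x - q x * gh x)"
    by (simp add: algebra_simps)
  ultimately have "(LINT x|M. g x * q x) = (LINT x|M. q x * gh x)" using gq int by simp
  then have "(LINT x|M. q x * wdiv \<Omega> uh x - q x * gh x) = 0" using div[OF q] int by simp
  moreover have "(LINT x|M. (q x)\<^sup>2) = (LINT x|M. q x * wdiv \<Omega> uh x - q x * gh x)"
    by (simp add: q_def power2_eq_square algebra_simps)
  ultimately have "(LINT x|M. (q x)\<^sup>2) = 0" by simp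
  then have "AE x in M. (q x)\<^sup>2 = 0"
    using int(3) by (subst (asm) integral_nonneg_eq_0_iff_AE) auto
  then show ?thesis by eventually_elim (simp add: q_def)
qed

section \<open>Contraction of the multiplier error\<close>

theorem ALM_linear_convergence:
  assumes g: "g \<in> L2_space \<Omega>" and proj: "is_L2_projection \<Omega> Mh g gh"
    and sol: "discrete_DF_solution \<Omega> \<mu> \<rho> \<beta> K f g Xh Mh uh ph" and p0: "p0 \<in> Mh"
  shows "\<exists>m>0. \<forall>\<epsilon>>0. \<forall>u p. ALM_sequence \<Omega> F Xh gh \<epsilon> p0 u p \<longrightarrow>
    (\<forall>n. bregman_sym F (u (Suc n)) uh \<le> \<epsilon> / 4 * (L2_norm \<Omega> (\<lambda>x. p n x - ph x))\<^sup>2 \<and>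
      \<epsilon> / 4 * (L2_norm \<Omega> (\<lambda>x. p n x - ph x))\<^sup>2
        \<le> \<epsilon> / 4 * (\<epsilon> / (m + \<epsilon>)) ^ (2 * n) * (L2_norm \<Omega> (\<lambda>x. p0 x - ph x))\<^sup>2)"
proof -
  have uh: "uh \<in> Xh" and ph: "ph \<in> Mh"
    and momentum: "\<And>v. v \<in> Xh \<Longrightarrow> a uh v - (LINT x|M. ph x * wdiv \<Omega> v x) = (LINT x|M. f x \<bullet> v x)"
    and mass: "\<And>q. q \<in> Mh \<Longrightarrow> (LINT x|M. q x * wdiv \<Omega> uh x) = (LINT x|M. g x * q x)"
    using sol by (auto simp: discrete_DF_solution_def DF_form_def)
  have gh: "gh \<in> Mh" using proj by (simp add: is_L2_projection_def)
  have div_uh: "AE x in M. wdiv \<Omega> uh x = gh x"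
    using g proj uh mass by (rule wdiv_discrete_solution)
  have norm_sq: "(L2_norm \<Omega> q)\<^sup>2 = (LINT x|M. (q x)\<^sup>2)" for q
    by (simp add: L2_norm_def)
  define R where "R = (LINT x|M. (p0 x - ph x)\<^sup>2)"
  have "R \<ge> 0" by (simp add: R_def)
  \<comment> \<open>The constant is fixed from the initial error \<open>R\<close> before any
    \<open>\<epsilon>\<close> or any iterates are introduced.\<close>
  obtain m where "m > 0" and m: "\<And>u e. u \<in> Xh \<Longrightarrow> e \<in> Mh \<Longrightarrow> (LINT x|M. (e x)\<^sup>2) \<le> R \<Longrightarrow>
      (\<And>v. v \<in> Xh \<Longrightarrow> a u v - a uh v = (LINT x|M. e x * wdiv \<Omega> v x)) \<Longrightarrow>
      m * (LINT x|M. (e x)\<^sup>2) \<le> a u (\<lambda>x. u x - uh x) - a uh (\<lambda>x. u x - uh x)"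
    using bregman_bounds_multiplier[OF uh \<open>R \<ge> 0\<close>] by blast
  obtain c where "c > 0" and coercive: "\<And>u v. ess_bounded M u \<Longrightarrow> ess_bounded M v \<Longrightarrow>
      c * (LINT x|M. (norm (u x - v x))\<^sup>2) \<le> a u (\<lambda>x. u x - v x) - a v (\<lambda>x. u x - v x)"
    using DF_form_coercive by blast
  show ?thesis
  proof (intro exI[of _ m] conjI allI impI)
    show "m > 0" by fact
  next
    fix \<epsilon> :: real and u p n
    assume \<epsilon>: "\<epsilon> > 0" and "ALM_sequence \<Omega> F Xh gh \<epsilon> p0 u p"
    then have p_0: "p 0 = p0"
      and min: "\<And>n. is_arg_min (\<lambda>v. F v - (LINT x|M. p n x * wdiv \<Omega> v x)
          + 1 / (2 * \<epsilon>) * (LINT x|M. (wdiv \<Omega> v x - gh x)\<^sup>2)) (\<lambda>v. v \<in> Xh) (u (Suc n))"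
      and upd: "\<And>n. AE x in M. p (Suc n) x = p n x - inverse \<epsilon> * (wdiv \<Omega> (u (Suc n)) x - gh x)"
      by (auto simp: ALM_sequence_def)
    have u: "u (Suc n) \<in> Xh" for n using min[of n] by (simp add: is_arg_min_def)
    have p: "p n \<in> Mh" for n
    proof (induction n)
      case 0
      then show ?case using p0 p_0 by simp
    next
      case (Suc n)
      have "(\<lambda>x. p n x + (- inverse \<epsilon>) * (wdiv \<Omega> (u (Suc n)) x - gh x)) \<in> Mh"
        by (intro Mh_add_scale Mh_diff Suc wdiv_in_Mh u gh)
      then show ?case by (rule Mh_cong_AE) (use upd[of n] in simp)
    qed
    define e where "e n x = p n x - ph x" for n x
    define N where "N n = (LINT x|M. (e n x)\<^sup>2)" for n
    define P where "P n = (LINT x|M. e (Suc n) x * e n x)" for n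
    define D where "D n = a (u (Suc n)) (\<lambda>x. u (Suc n) x - uh x) - a uh (\<lambda>x. u (Suc n) x - uh x)" for n
    have e: "e n \<in> Mh" for n unfolding e_def[abs_def] by (intro Mh_diff p ph)
    have eb: "ess_bounded M (e n)" for n using e by (rule Mh_ess_bounded)
    have int: "integrable M (\<lambda>x. (e n x)\<^sup>2)" "integrable M (\<lambda>x. e (Suc n) x * e n x)" for n
      by (intro integrable_ess_bounded ess_bounded_mult ess_bounded_power eb)+
    have N_nonneg: "N n \<ge> 0" for n by (simp add: N_def)
    have residual: "a (u (Suc n)) v - a uh v = (LINT x|M. e (Suc n) x * wdiv \<Omega> v x)" if v: "v \<in> Xh" for n v
    proof -
      have "integrable M (\<lambda>x. p (Suc n) x * wdiv \<Omega> v x)" "integrable M (\<lambda>x. ph x * wdiv \<Omega> v x)"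
        by (intro integrable_ess_bounded ess_bounded_mult Mh_ess_bounded p ph wdiv_in_Mh v)+
      then have "(LINT x|M. e (Suc n) x * wdiv \<Omega> v x)
          = (LINT x|M. p (Suc n) x * wdiv \<Omega> v x) - (LINT x|M. ph x * wdiv \<Omega> v x)"
        by (simp add: e_def left_diff_distrib)
      then show ?thesis
        using augmented_Lagrangian_optimality[OF min p gh p upd v, of n] momentum[OF v] by simp
    qed
    have D_eq: "D n = \<epsilon> * (P n - N (Suc n))" for n
    proof -
      have w: "(\<lambda>x. u (Suc n) x - uh x) \<in> Xh" by (intro Xh_diff u uh)
      have "AE x in M. wdiv \<Omega> (\<lambda>x. u (Suc n) x - uh x) x = wdiv \<Omega> (u (Suc n)) x - wdiv \<Omega> uh x"
        using wdiv_add_scaleR[OF u uh, of n "- 1"] by simp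
      with div_uh upd[of n]
      have "AE x in M. e (Suc n) x * wdiv \<Omega> (\<lambda>x. u (Suc n) x - uh x) x
          = \<epsilon> * (e (Suc n) x * e n x - (e (Suc n) x)\<^sup>2)"
      proof eventually_elim
        case (elim x)
        then have eq: "\<epsilon> * (e n x - e (Suc n) x) = wdiv \<Omega> (\<lambda>x. u (Suc n) x - uh x) x"
          using \<epsilon> by (simp add: e_def)
        show ?case unfolding eq[symmetric] by (simp add: power2_eq_square algebra_simps)
      qed
      then have "(LINT x|M. e (Suc n) x * wdiv \<Omega> (\<lambda>x. u (Suc n) x - uh x) x)
          = (LINT x|M. \<epsilon> * (e (Suc n) x * e n x - (e (Suc n) x)\<^sup>2))"
        by (rule integral_cong_AE[rotated 2])
           (intro ess_bounded_measurable ess_bounded_intros eb wdiv_ess_bounded w)+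
      then show ?thesis
        unfolding D_def using residual[OF w] int by (simp add: P_def N_def)
    qed
    have D_nonneg: "D n \<ge> 0" for n
    proof -
      have "0 \<le> c * (LINT x|M. (norm (u (Suc n) x - uh x))\<^sup>2)"
        using \<open>c > 0\<close> by simp
      also have "\<dots> \<le> D n" unfolding D_def by (intro coercive Xh_ess_bounded u uh)
      finally show ?thesis .
    qed
    have CS: "(P n)\<^sup>2 \<le> N (Suc n) * N n" for n
      unfolding P_def N_def by (intro L2_Cauchy_Schwarz eb)
    \<comment> \<open>Kept general in \<open>k\<close> because it is used twice. Taking
      \<open>k = 0\<close> shows that the error never grows, hence stays below \<open>R\<close>;
      only then is the lower bound with \<open>k = m\<close> available.\<close>
    have contract: "N (Suc n) \<le> (\<epsilon> / (k + \<epsilon>))\<^sup>2 * N n" if "k \<ge> 0" and k: "k * N (Suc n) \<le> D n" for n k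
    proof (cases "N (Suc n) = 0")
      case False
      then have pos: "N (Suc n) > 0" using N_nonneg[of "Suc n"] by simp
      have "(k + \<epsilon>) * N (Suc n) \<le> \<epsilon> * P n" using k by (simp add: D_eq algebra_simps)
      then have "((k + \<epsilon>) * N (Suc n))\<^sup>2 \<le> (\<epsilon> * P n)\<^sup>2"
        using \<open>k \<ge> 0\<close> \<epsilon> pos by (intro power_mono) auto
      also have "\<dots> \<le> \<epsilon>\<^sup>2 * (N (Suc n) * N n)"
        unfolding power_mult_distrib using CS by (intro mult_left_mono) auto
      finally have "N (Suc n) * ((k + \<epsilon>)\<^sup>2 * N (Suc n)) \<le> N (Suc n) * (\<epsilon>\<^sup>2 * N n)"
        by (simp add: power2_eq_square mult_ac)
      then have "(k + \<epsilon>)\<^sup>2 * N (Suc n) \<le> \<epsilon>\<^sup>2 * N n" using pos by simp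
      moreover have "(k + \<epsilon>)\<^sup>2 > 0" using \<open>k \<ge> 0\<close> \<epsilon> by simp
      ultimately show ?thesis by (simp add: power_divide field_simps)
    qed (use N_nonneg in simp)
    have N_le: "N n \<le> R" for n
    proof (induction n)
      case 0
      then show ?case by (simp add: N_def R_def e_def p_0)
    next
      case (Suc n)
      have "N (Suc n) \<le> N n" using contract[of 0 n] D_nonneg[of n] \<epsilon> by simp
      then show ?case using Suc by linarith
    qed
    have step: "N (Suc n) \<le> (\<epsilon> / (m + \<epsilon>))\<^sup>2 * N n" for n
    proof (rule contract)
      show "m * N (Suc n) \<le> D n"
        unfolding D_def N_def using N_le[of "Suc n"]
        by (intro m u e residual) (simp_all add: N_def)
    qed (use \<open>m > 0\<close> in simp)
    have rate: "N n \<le> (\<epsilon> / (m + \<epsilon>)) ^ (2 * n) * N 0" for n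
    proof (induction n)
      case (Suc n)
      have "N (Suc n) \<le> (\<epsilon> / (m + \<epsilon>))\<^sup>2 * N n" by (rule step)
      also have "\<dots> \<le> (\<epsilon> / (m + \<epsilon>))\<^sup>2 * ((\<epsilon> / (m + \<epsilon>)) ^ (2 * n) * N 0)"
        by (intro mult_left_mono Suc) simp
      also have "\<dots> = (\<epsilon> / (m + \<epsilon>)) ^ (2 * Suc n) * N 0"
        by (simp add: power_add[symmetric] flip: mult.assoc)
      finally show ?case .
    qed simp
    have norm_N: "(L2_norm \<Omega> (\<lambda>x. p n x - ph x))\<^sup>2 = N n" for n
      by (simp add: norm_sq N_def e_def)
    have "D n \<le> \<epsilon> / 4 * N n" for n
    proof -
      \<comment> \<open>Completing the square in the new error is the origin of the factor
        1/4.\<close>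
      have "0 \<le> (LINT x|M. (e (Suc n) x - e n x / 2)\<^sup>2)" by simp
      also have "\<dots> = (LINT x|M. (e (Suc n) x)\<^sup>2 - e (Suc n) x * e n x + (e n x)\<^sup>2 / 4)"
        by (rule Bochner_Integration.integral_cong) (auto simp: power2_eq_square field_simps)
      also have "\<dots> = N (Suc n) - P n + N n / 4"
        using int by (simp add: N_def P_def)
      finally have "P n - N (Suc n) \<le> N n / 4" by simp
      then have "\<epsilon> * (P n - N (Suc n)) \<le> \<epsilon> * (N n / 4)" using \<epsilon> by (intro mult_left_mono) auto
      then show ?thesis by (simp add: D_eq)
    qed
    then show "bregman_sym F (u (Suc n)) uh \<le> \<epsilon> / 4 * (L2_norm \<Omega> (\<lambda>x. p n x - ph x))\<^sup>2"
      by (simp add: bregman_sym_energy[OF u uh] D_def norm_N)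
    have "\<epsilon> / 4 * N n \<le> \<epsilon> / 4 * ((\<epsilon> / (m + \<epsilon>)) ^ (2 * n) * N 0)"
      using rate \<epsilon> by (intro mult_left_mono) auto
    then show "\<epsilon> / 4 * (L2_norm \<Omega> (\<lambda>x. p n x - ph x))\<^sup>2
        \<le> \<epsilon> / 4 * (\<epsilon> / (m + \<epsilon>)) ^ (2 * n) * (L2_norm \<Omega> (\<lambda>x. p0 x - ph x))\<^sup>2"
      using norm_N[of n] norm_N[of 0] by (simp add: p_0 mult.assoc)
  qed
qed

end

theorem theorem3p1:
  fixes \<Omega> :: "(real ^ 'd) set"
    and \<T> :: "(real ^ 'd) set set"
    and \<sigma> \<mu> \<rho> \<beta> :: real
    and K :: "real ^ 'd \<Rightarrow> real ^ 'd ^ 'd"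
    and f :: "real ^ 'd \<Rightarrow> real ^ 'd"
    and g gh :: "real ^ 'd \<Rightarrow> real"
    and Xh :: "(real ^ 'd \<Rightarrow> real ^ 'd) set"
    and Mh :: "(real ^ 'd \<Rightarrow> real) set"
    and uh :: "real ^ 'd \<Rightarrow> real ^ 'd"
    and ph p0 :: "real ^ 'd \<Rightarrow> real"
  assumes "CARD('d) = 2 \<or> CARD('d) = 3"
    and "bounded \<Omega>" and "polyhedral_domain \<Omega>"
    and "\<mu> > 0" and "\<rho> > 0" and "\<beta> \<ge> 0"
    and "permeability_tensor \<Omega> K"
    and "bounded_load \<Omega> f"
    and "g \<in> L2_space \<Omega>"
    and "partition_of_domain \<Omega> \<T>" and "quasi_uniform \<sigma> \<T>"
    and "RT_type_pair \<Omega> \<T> Xh Mh"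
    and "is_L2_projection \<Omega> Mh g gh"
    and "discrete_DF_solution \<Omega> \<mu> \<rho> \<beta> K f g Xh Mh uh ph"
    and "p0 \<in> Mh"
  shows "\<exists>mu_star>0. \<forall>\<epsilon>>0. \<forall>u p.
           ALM_sequence \<Omega> (DF_energy \<Omega> \<mu> \<rho> \<beta> K f) Xh gh \<epsilon> p0 u p \<longrightarrow>
           (\<forall>n. bregman_sym (DF_energy \<Omega> \<mu> \<rho> \<beta> K f) (u (Suc n)) uh
                  \<le> \<epsilon> / 4 * (L2_norm \<Omega> (\<lambda>x. p n x - ph x))\<^sup>2 \<and>
                \<epsilon> / 4 * (L2_norm \<Omega> (\<lambda>x. p n x - ph x))\<^sup>2
                  \<le> \<epsilon> / 4 * (\<epsilon> / (mu_star + \<epsilon>)) ^ (2 * n) * (L2_norm \<Omega> (\<lambda>x. p0 x - ph x))\<^sup>2)"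
proof -
  interpret discrete_DF \<Omega> \<mu> \<rho> \<beta> K \<T> Xh Mh f
    using assms by unfold_locales (auto simp: polyhedral_domain_def)
  show ?thesis
    using assms by (intro ALM_linear_convergence)
qed

end
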